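(* Let $\alpha\ge 1/2$ and $\lambda>0$. Let $X$ be an almost surely positive random variable with $\mathbb{E}[X^{\alpha+4}]<\infty$, and let $(X_\tau)_{\tau\in(0,1)}$ be the gamma smart path built from $X$. Then for every $\tau\in(0,1)$ the function $\tau\mapsto D(X_\tau\|\gamma_{\alpha,\lambda})$ is finite and differentiable, and $$\frac{d}{d\tau}D(X_\tau\|\gamma_{\alpha,\lambda})=\frac{1}{\lambda\tau}\,J_{st,\gamma}(X_\tau).$$
   Context: Fix $\alpha>0,\lambda>0$. Let $\gamma_{\alpha,\lambda}(u)=\frac{\lambda^\alpha}{\Gamma(\alpha)}u^{\alpha-1}e^{-\lambda u}$, $u>0$, and let $\gamma(\alpha,\lambda)$ denote a random variable with this density. Let $X$ be a random variable with values in $(0,\infty)$ a.s. and law $\mathbb{P}_X$. For $\tau\in(0,1)$, the gamma smart path $X_\tau$ is defined as follows: conditionally on $X=x$, let $K$ be Poisson with mean $\lambda\tau x/(1-\tau)$; conditionally on $X=x,K=k$, let $Y=0$ if $k=0$ and let $Y$ be gamma distributed with shape $k$ and rate $\lambda\tau/(1-\tau)$ if $k\ge1$; let $\gamma(\alpha,\lambda)$ be independent of $(X,K,Y)$; set $X_\tau=(1-\tau)\gamma(\alpha,\lambda)+\tau Y$. $X_\tau$ has the Lebesgue density $$g(\tau,u)=\frac{\lambda}{1-\tau}\Big(\frac{u}{\tau}\Big)^{\frac{\alpha-1}{2}}e^{-\frac{\lambda u}{1-\tau}}\int_0^\infty x^{-\frac{\alpha-1}{2}}e^{-\frac{\lambda\tau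 x}{1-\tau}}I_{\alpha-1}\Big(\frac{2\lambda\sqrt{ux\tau}}{1-\tau}\Big)\mathbb{P}_X(dx),$$ where $I_\nu$ is the modified Bessel function of the first kind. For a positive random variable $W$ with density $f$, $D(W\|\gamma_{\alpha,\lambda})=\int_0^\infty f\log(f/\gamma_{\alpha,\lambda})$ (and $+\infty$ if $W$ has no density). For a positive random variable $W$ with differentiable positive density $f_W$, let $\rho_W(u)=\frac{d}{du}\log f_W(u)$ and define the standardized Fisher information $J_{st,\gamma}(W)=\mathbb{E}\big[W\big(\rho_W(W)-\frac{\alpha-1}{W}+\lambda\big)^2\big]$. *)

theory Defs
  imports "HOL-Probability.Probability"
begin

definition bessel_I :: "real \<Rightarrow> real \<Rightarrow> real" where
  "bessel_I nu z = (\<Sum>m. (z / 2) powr (2 * real m + nu) / (fact m * Gamma (real m + nu + 1)))"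

definition gamma_dens :: "real \<Rightarrow> real \<Rightarrow> real \<Rightarrow> real" where
  "gamma_dens a lam u = lam powr a / Gamma a * u powr (a - 1) * exp (- lam * u)"

text \<open>Lebesgue density g(tau,u) of the gamma smart path X_tau built from a
  random variable X with law P.\<close>
definition smart_path_dens :: "real \<Rightarrow> real \<Rightarrow> real measure \<Rightarrow> real \<Rightarrow> real \<Rightarrow> real" where
  "smart_path_dens a lam P \<tau> u =
     lam / (1 - \<tau>) * (u / \<tau>) powr ((a - 1) / 2) * exp (- lam * u / (1 - \<tau>)) *
     (LINT x|P. x powr (- (a - 1) / 2) * exp (- lam * \<tau> * x / (1 - \<tau>)) *
        bessel_I (a - 1) (2 * lam * sqrt (u * x * \<tau>) / (1 - \<tau>)))"

definition rel_entropy_gamma :: "real \<Rightarrow> real \<Rightarrow> (real \<Rightarrow> real) \<Rightarrow> real" where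
  "rel_entropy_gamma a lam f = (LBINT u:{0<..}. f u * ln (f u / gamma_dens a lam u))"

text \<open>Standardized Fisher information J_{st,gamma}(W) = E[W (rho_W(W) - (alpha-1)/W + lambda)^2]
  for W with positive differentiable density f, rho_W = (log f)'.\<close>
definition fisher_integrand :: "real \<Rightarrow> real \<Rightarrow> (real \<Rightarrow> real) \<Rightarrow> real \<Rightarrow> real" where
  "fisher_integrand a lam f u =
     f u * (u * (deriv (\<lambda>v. ln (f v)) u - (a - 1) / u + lam)\<^sup>2)"

definition J_st_gamma :: "real \<Rightarrow> real \<Rightarrow> (real \<Rightarrow> real) \<Rightarrow> real" where
  "J_st_gamma a lam f = (LBINT u:{0<..}. fisher_integrand a lam f u)"

end

theory Submission
  imports Defs "HOL-Real_Asymp.Real_Asymp"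
begin

text \<open>
  Write \<open>r = lam \<tau> / (1 - \<tau>)\<close>. Expanding the Bessel function, \<open>X_\<tau>\<close> has density \<open>h r\<close> with respect
  to the gamma law, where \<open>h r u\<close> mixes \<open>((lam + r) / lam)\<^sup>a exp (- r (u + x)) w (r (lam + r) u x)\<close> over the
  law of \<open>x\<close>, and \<open>w\<close> is the entire function solving \<open>z w'' + a w' = w\<close>, \<open>w 0 = 1\<close>. This differential
  equation makes \<open>h\<close> a solution of the heat equation of the Laguerre generator. Differentiating the
  entropy under the integral sign and integrating by parts then gives the Fisher information.

  For \<open>a \<ge> 1/2\<close> one has \<open>w z \<le> cosh (2 sqrt z)\<close>, which bounds the mixture kernel times the gamma density by
  \<open>C u\<^sup>a\<^sup>-\<^sup>1 exp (- (sqrt ((lam + r) u) - sqrt (r x))\<^sup>2)\<close> and hence by \<open>C u\<^sup>a\<^sup>-\<^sup>1 ((1 + x) / (1 + u))\<^sup>p\<close> for every \<open>p > 0\<close>.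
  Spending the moment of order \<open>a + 4\<close> on the powers of \<open>x\<close> leaves enough decay in \<open>u\<close> to dominate every
  integrand, locally uniformly in \<open>r\<close>, by a multiple of \<open>u\<^sup>a\<^sup>-\<^sup>1 (1 + u)\<^sup>-\<^sup>a\<^sup>-\<^sup>1\<close>.
\<close>

subsection \<open>The confluent hypergeometric limit function\<close>

text \<open>The function \<open>0F1(; a; z)\<close>. Removing the factor \<open>powr\<close> from
  the Bessel function leaves a power series in \<open>z\<close>, which can be differentiated term by
  term at every argument.\<close>

definition hyp01 :: "real \<Rightarrow> real \<Rightarrow> real" where
  "hyp01 a z = (\<Sum>m. z ^ m / (fact m * pochhammer a m))"

lemma pochhammer_mono_real:
  fixes a b :: real
  assumes "0 < a" "a \<le> b"
  shows "pochhammer a n \<le> pochhammer b n"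
proof (induction n)
  case (Suc n)
  have "pochhammer a n * (a + n) \<le> pochhammer b n * (b + n)"
    using assms Suc pochhammer_pos[of b n] by (intro mult_mono) (auto intro: less_imp_le)
  then show ?case by (simp add: pochhammer_Suc)
qed simp

text \<open>At \<open>a = 1/2\<close> the terms are exactly those of
  \<open>cosh (2 * sqrt z)\<close>, because \<open>(2 m)! = 4 ^ m * pochhammer (1/2) m * m!\<close>;
  a larger \<open>a\<close> enlarges the denominators. The condition \<open>a \<ge> 1/2\<close>
  serves this comparison.\<close>

lemma hyp01_term_le:
  fixes a z :: real
  assumes "a \<ge> 1/2" "z \<ge> 0"
  shows "z ^ m / (fact m * pochhammer a m) \<le> (2 * sqrt z) ^ (2 * m) / fact (2 * m)"
proof -
  have p: "0 < pochhammer (1/2::real) m" by (simp add: pochhammer_pos)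
  have "z ^ m / (fact m * pochhammer a m) \<le> z ^ m / (fact m * pochhammer (1/2) m)"
    using assms p pochhammer_mono_real[of "1/2" a m] by (intro divide_left_mono mult_left_mono mult_pos_pos) auto
  also have "\<dots> = (2 * sqrt z) ^ (2 * m) / fact (2 * m)"
  proof -
    have "(2 * sqrt z) ^ (2 * m) = 4 ^ m * z ^ m" "(fact (2 * m) :: real) = 4 ^ m * pochhammer (1/2) m * fact m"
      using assms(2) by (simp_all add: fact_double power_mult power_mult_distrib)
    then show ?thesis by simp
  qed
  finally show ?thesis .
qed

lemma cosh_even_sums: "(\<lambda>m. y ^ (2 * m) / fact (2 * m)) sums cosh (y::real)"
proof -
  \<comment> \<open>The power series of \<open>cosh\<close> carries zeros at odd indices; reindexing
    along the even numbers drops them.\<close>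
  have "(\<lambda>m. (\<lambda>n. if even n then y ^ n /\<^sub>R fact n else 0) (2 * m)) sums cosh y"
    by (subst sums_mono_reindex[of "\<lambda>m. 2 * m"])
      (auto simp: strict_mono_def cosh_converges elim!: evenE)
  then show ?thesis by (simp add: divide_inverse mult.commute)
qed

lemma hyp01_summable:
  fixes a z :: real
  assumes "a \<ge> 1/2"
  shows "summable (\<lambda>m. z ^ m / (fact m * pochhammer a m))"
proof (rule summable_comparison_test')
  show "summable (\<lambda>m. (2 * sqrt \<bar>z\<bar>) ^ (2 * m) / fact (2 * m))"
    using cosh_even_sums sums_summable by blast
  show "norm (z ^ m / (fact m * pochhammer a m)) \<le> (2 * sqrt \<bar>z\<bar>) ^ (2 * m) / fact (2 * m)" for m
    using hyp01_term_le[of a "\<bar>z\<bar>" m] assms pochhammer_pos[of a m] by (simp add: power_abs)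
qed

lemma hyp01_nonneg_bounds:
  fixes a z :: real
  assumes "a \<ge> 1/2" "z \<ge> 0"
  shows hyp01_ge_1: "1 \<le> hyp01 a z"
    and hyp01_le_exp: "hyp01 a z \<le> exp (2 * sqrt z)"
proof -
  \<comment> \<open>The term of index 0 is 1 and all others are nonnegative.\<close>
  have "(\<Sum>m<1. z ^ m / (fact m * pochhammer a m)) \<le> hyp01 a z"
    unfolding hyp01_def using assms pochhammer_nonneg[of a]
    by (intro sum_le_suminf hyp01_summable) auto
  then show "1 \<le> hyp01 a z" by simp
  have "hyp01 a z \<le> cosh (2 * sqrt z)"
    unfolding hyp01_def sums_unique[OF cosh_even_sums]
    by (intro suminf_le hyp01_term_le hyp01_summable sums_summable[OF cosh_even_sums] assms)
  also have "\<dots> \<le> exp (2 * sqrt z)"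
    using assms(2) by (simp add: cosh_def field_simps)
  finally show "hyp01 a z \<le> exp (2 * sqrt z)" .
qed

text \<open>Each denominator grows with the parameter. Later this allows \<open>T 1 1\<close> to be
  replaced by \<open>T 0 1\<close> ahead of Cauchy--Schwarz.\<close>

lemma hyp01_mono_param:
  fixes a z :: real
  assumes "1/2 \<le> a" "a \<le> b" "z \<ge> 0"
  shows "hyp01 b z \<le> hyp01 a z"
  unfolding hyp01_def
proof (intro suminf_le hyp01_summable)
  fix m
  show "z ^ m / (fact m * pochhammer b m) \<le> z ^ m / (fact m * pochhammer a m)"
    using assms pochhammer_mono_real[of a b m] pochhammer_pos[of a m] pochhammer_pos[of b m]
    by (intro divide_left_mono mult_left_mono mult_pos_pos) auto
qed (use assms in auto)

text \<open>Termwise differentiation: the exponent cancels the top factor of the factorial, and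
  splitting the first factor \<open>a\<close> off the Pochhammer symbol raises the parameter by
  one.\<close>

lemma has_real_derivative_hyp01:
  assumes "a \<ge> 1/2"
  shows "(hyp01 a has_real_derivative hyp01 (a + 1) z / a) (at z)"
proof -
  define c where "c m = 1 / (fact m * pochhammer a m)" for m
  have "summable (\<lambda>m. c m * y ^ m)" for y
    using hyp01_summable[OF assms, of y] by (simp add: c_def)
  then have "((\<lambda>z. \<Sum>m. c m * z ^ m) has_field_derivative (\<Sum>m. diffs c m * z ^ m)) (at z)"
    by (rule termdiffs_strong_converges_everywhere)
  moreover have "diffs c m = 1 / (fact m * pochhammer (a + 1) m) / a" for m
    using assms pochhammer_pos[of "a + 1" m]
    by (simp add: diffs_def c_def pochhammer_rec del: of_nat_Suc)
  then have "(\<Sum>m. diffs c m * z ^ m) = hyp01 (a + 1) z / a"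
    unfolding hyp01_def using hyp01_summable[of "a + 1" z] assms
    by (subst suminf_divide [symmetric]) (simp_all add: mult.commute)
  moreover have "(\<lambda>z. \<Sum>m. c m * z ^ m) = hyp01 a"
    by (simp add: hyp01_def c_def fun_eq_iff)
  ultimately show ?thesis by simp
qed

text \<open>This contiguity relation is the differential equation \<open>z w'' + a w' = w\<close>
  of \<open>w = hyp01 a\<close>, written without derivatives.\<close>
lemma hyp01_contiguous:
  assumes "a \<ge> 1/2"
  shows "hyp01 a z = hyp01 (a + 1) z + z * hyp01 (a + 2) z / (a * (a + 1))"
proof -
  define f where "f m = z ^ m / (fact m * pochhammer a m) - z ^ m / (fact m * pochhammer (a + 1) m)" for m
  have s: "summable f"
    unfolding f_def by (intro summable_diff hyp01_summable) (use assms in auto)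
  have "f (Suc m) = z / (a * (a + 1)) * (z ^ m / (fact m * pochhammer (a + 2) m))" for m
  proof -
    have p: "pochhammer (a + 2) m > 0" "a > 0" "a + 1 + m > 0"
      using assms by (auto intro: pochhammer_pos)
    have 1: "pochhammer (a + 1) (Suc m) = (a + 1) * pochhammer (a + 2) m"
      by (simp add: pochhammer_rec add.commute)
    have 2: "pochhammer a (Suc m) * (a + 1 + m) = a * (a + 1) * pochhammer (a + 2) m"
      using pochhammer_Suc[of a "Suc m"] pochhammer_rec[of a "Suc m"] 1
      by (simp add: algebra_simps)
    then have 3: "pochhammer a (Suc m) = a * (a + 1) * pochhammer (a + 2) m / (a + 1 + m)"
      using p by (simp add: eq_divide_eq)
    \<comment> \<open>The term of index \<open>Suc m\<close> for parameter \<open>a + 1\<close>. The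
      one for \<open>a\<close> is \<open>K * (a + 1 + m) / a\<close>, and in the difference
      \<open>K * Suc m / a\<close> the factor \<open>Suc m\<close> cancels in the factorial, which
      shifts the index.\<close>
    define K where "K = z ^ Suc m / (fact (Suc m) * ((a + 1) * pochhammer (a + 2) m))"
    have "f (Suc m) = K * (a + 1 + m) / a - K"
      unfolding f_def 1 3 K_def by (simp add: mult_ac)
    also have "\<dots> = K * real (Suc m) / a"
      using p(2) by (simp add: field_simps)
    also have "\<dots> = z / (a * (a + 1)) * (z ^ m / (fact m * pochhammer (a + 2) m))"
      by (simp add: K_def mult_ac del: of_nat_Suc)
    finally show ?thesis .
  qed
  then have "(\<Sum>m. f (Suc m)) = z / (a * (a + 1)) * hyp01 (a + 2) z"
    unfolding hyp01_def by (simp only:) (intro suminf_mult hyp01_summable, use assms in simp)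
  \<comment> \<open>Both terms of index 0 equal 1, so \<open>f 0 = 0\<close>.\<close>
  then have "suminf f = z / (a * (a + 1)) * hyp01 (a + 2) z"
    using suminf_split_head[OF s] by (simp add: f_def[of 0])
  moreover have "suminf f = hyp01 a z - hyp01 (a + 1) z"
    unfolding f_def hyp01_def using assms
    by (intro suminf_diff [symmetric] hyp01_summable) auto
  ultimately show ?thesis by simp
qed

lemma continuous_on_hyp01: "a \<ge> 1/2 \<Longrightarrow> continuous_on S (hyp01 a)"
  by (meson DERIV_isCont continuous_at_imp_continuous_on has_real_derivative_hyp01)

lemma borel_measurable_hyp01 [measurable (raw)]:
  assumes "a \<ge> 1/2" "f \<in> borel_measurable M"
  shows "(\<lambda>x. hyp01 a (f x)) \<in> borel_measurable M"
  using borel_measurable_continuous_onI[OF continuous_on_hyp01[OF assms(1)]] assms(2)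
  by (rule measurable_compose[rotated])

text \<open>\<open>Gamma (a + m) = pochhammer a m * Gamma a\<close> turns the Bessel coefficients
  into those of \<open>hyp01\<close>; for \<open>z > 0\<close> the real exponent
  \<open>2 * m\<close> becomes an ordinary power.\<close>

lemma bessel_I_eq_hyp01:
  assumes "a \<ge> 1/2" "z > 0"
  shows "bessel_I (a - 1) z = (z / 2) powr (a - 1) / Gamma a * hyp01 a ((z / 2)\<^sup>2)"
proof -
  have "(z / 2) powr (2 * real m + (a - 1)) / (fact m * Gamma (real m + (a - 1) + 1))
      = (z / 2) powr (a - 1) / Gamma a * (((z / 2)\<^sup>2) ^ m / (fact m * pochhammer a m))" for m
  proof -
    have "a \<notin> \<int>\<^sub>\<le>\<^sub>0" using assms by (auto elim!: nonpos_Ints_cases)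
    then have "Gamma (a + real m) = pochhammer a m * Gamma a"
      using pochhammer_Gamma[of a m] less_imp_neq[OF Gamma_real_pos[of a]] assms by simp
    then have "Gamma (real m + (a - 1) + 1) = pochhammer a m * Gamma a"
      by (simp add: algebra_simps)
    moreover have "(z / 2) powr (2 * real m + (a - 1)) = ((z / 2)\<^sup>2) ^ m * (z / 2) powr (a - 1)"
      using assms powr_realpow[of "z / 2" "2 * m"]
      by (simp add: powr_add power_mult[symmetric])
    ultimately show ?thesis by (simp add: mult_ac)
  qed
  then show ?thesis
    unfolding bessel_I_def hyp01_def
    by (simp only:) (intro suminf_mult hyp01_summable assms)
qed

subsection \<open>Analytic tools\<close>

text \<open>Differentiation under the integral sign. The mean value inequality bounds every
  difference quotient by \<open>B\<close>, so dominated convergence applies along each sequence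
  tending to \<open>r0\<close>. One null set serves all parameters \<open>r\<close>.\<close>

lemma has_real_derivative_integral:
  fixes f f' :: "real \<Rightarrow> 'a \<Rightarrow> real"
  assumes r0: "r0 \<in> {l<..<R}"
    and int: "\<And>r. r \<in> {l<..<R} \<Longrightarrow> integrable M (f r)"
    and f'[measurable]: "f' r0 \<in> borel_measurable M"
    and B: "integrable M B"
    and der: "AE x in M. \<forall>r\<in>{l<..<R}. ((\<lambda>r. f r x) has_real_derivative f' r x) (at r) \<and> \<bar>f' r x\<bar> \<le> B x"
  shows "((\<lambda>r. integral\<^sup>L M (f r)) has_real_derivative integral\<^sup>L M (f' r0)) (at r0)"
    and "integrable M (f' r0)"
proof -
  show "integrable M (f' r0)"
    using der r0 by (intro Bochner_Integration.integrable_bound[OF B])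
      (auto elim!: eventually_mono intro: order_trans[OF _ abs_ge_self])
  have "((\<lambda>r. (integral\<^sup>L M (f r) - integral\<^sup>L M (f r0)) / (r - r0)) \<longlongrightarrow> integral\<^sup>L M (f' r0)) (at r0)"
    unfolding tendsto_at_iff_sequentially
  proof (intro allI impI)
    fix X :: "nat \<Rightarrow> real"
    assume X: "\<forall>i. X i \<in> UNIV - {r0}" "X \<longlonglongrightarrow> r0"
    have "eventually (\<lambda>n. X n \<in> {l<..<R}) sequentially"
      by (rule topological_tendstoD[OF X(2) open_greaterThanLessThan r0])
    then obtain N where N: "\<And>n. n \<ge> N \<Longrightarrow> X n \<in> {l<..<R}"
      by (auto simp: eventually_sequentially)
    \<comment> \<open>Domination is available only inside the interval, so the first
      \<open>N\<close> terms are cut off; \<open>LIMSEQ_offset\<close> restores them.\<close>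
    define Y where "Y n = X (n + N)" for n
    have Y: "Y \<longlonglongrightarrow> r0" "Y n \<noteq> r0" "Y n \<in> {l<..<R}" for n
      using X N[of "n + N"] unfolding Y_def by (auto intro: LIMSEQ_ignore_initial_segment)
    have "(\<lambda>n. \<integral>x. (f (Y n) x - f r0 x) / (Y n - r0) \<partial>M) \<longlonglongrightarrow> integral\<^sup>L M (f' r0)"
    proof (rule integral_dominated_convergence[where w = B])
      show "(\<lambda>x. (f (Y n) x - f r0 x) / (Y n - r0)) \<in> borel_measurable M" for n
        using borel_measurable_integrable[OF int[OF Y(3)[of n]]] borel_measurable_integrable[OF int[OF r0]]
        by measurable
      show "AE x in M. (\<lambda>n. (f (Y n) x - f r0 x) / (Y n - r0)) \<longlonglongrightarrow> f' r0 x"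
        using der
      proof (rule eventually_mono)
        fix x assume "\<forall>r\<in>{l<..<R}. ((\<lambda>r. f r x) has_real_derivative f' r x) (at r) \<and> \<bar>f' r x\<bar> \<le> B x"
        then have "((\<lambda>r. (f r x - f r0 x) / (r - r0)) \<longlongrightarrow> f' r0 x) (at r0)"
          using r0 unfolding has_field_derivative_iff by blast
        then show "(\<lambda>n. (f (Y n) x - f r0 x) / (Y n - r0)) \<longlonglongrightarrow> f' r0 x"
          unfolding tendsto_at_iff_sequentially o_def using Y by auto
      qed
      show "AE x in M. norm ((f (Y n) x - f r0 x) / (Y n - r0)) \<le> B x" for n
        using der
      proof (rule eventually_mono)
        fix x assume D: "\<forall>r\<in>{l<..<R}. ((\<lambda>r. f r x) has_real_derivative f' r x) (at r) \<and> \<bar>f' r x\<bar> \<le> B x"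
        have "norm (f (Y n) x - f r0 x) \<le> B x * norm (Y n - r0)"
          by (rule field_differentiable_bound[of "{l<..<R}" "\<lambda>r. f r x" "\<lambda>r. f' r x"])
            (use D Y(3)[of n] r0 in \<open>auto intro: has_field_derivative_at_within\<close>)
        then show "norm ((f (Y n) x - f r0 x) / (Y n - r0)) \<le> B x"
          using Y(2)[of n] by (simp add: divide_le_eq)
      qed
    qed (use B in auto)
    moreover have "(\<integral>x. (f (Y n) x - f r0 x) / (Y n - r0) \<partial>M) = (integral\<^sup>L M (f (Y n)) - integral\<^sup>L M (f r0)) / (Y n - r0)" for n
      by (subst integral_divide_zero) (simp add: Bochner_Integration.integral_diff int[OF Y(3)[of n]] int[OF r0])
    ultimately have "(\<lambda>n. (\<lambda>r. (integral\<^sup>L M (f r) - integral\<^sup>L M (f r0)) / (r - r0)) (X (n + N))) \<longlonglongrightarrow> integral\<^sup>L M (f' r0)"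
      by (simp only: Y_def)
    then show "((\<lambda>r. (integral\<^sup>L M (f r) - integral\<^sup>L M (f r0)) / (r - r0)) \<circ> X) \<longlonglongrightarrow> integral\<^sup>L M (f' r0)"
      unfolding o_def by (rule LIMSEQ_offset)
  qed
  then show "((\<lambda>r. integral\<^sup>L M (f r)) has_real_derivative integral\<^sup>L M (f' r0)) (at r0)"
    by (simp add: has_field_derivative_iff)
qed

text \<open>The function \<open>p * ln y - c * y\<close> peaks at \<open>y = p / c\<close>; the
  inequality \<open>ln t \<le> t - 1\<close> at \<open>t = y * c / p\<close> expresses this, and the
  gain \<open>- p\<close> is discarded.\<close>

lemma powr_le_exp:
  fixes p c y :: real
  assumes "p > 0" "c > 0" "y > 0"
  shows "y powr p \<le> (p / c) powr p * exp (c * y)"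
proof -
  have "ln (y * c / p) \<le> y * c / p - 1"
    using assms by (intro ln_le_minus_one) auto
  then have "p * ln y \<le> p * ln (p / c) + (y * c - p)"
    using assms by (simp add: ln_mult ln_div field_simps)
  then have "exp (p * ln y) \<le> exp (p * ln (p / c) + c * y)"
    using assms by (simp add: mult.commute)
  then show ?thesis
    using assms by (simp add: powr_def exp_add)
qed

lemma power_over_fact_le_exp:
  fixes y :: real
  assumes "y \<ge> 0"
  shows "y ^ n / fact n \<le> exp y"
  using sum_le_suminf[OF summable_exp_generic[of y], of "{n}"] assms
  by (simp add: exp_def divide_inverse mult.commute)

section \<open>Integrals over the half-line\<close>

text \<open>The nonnegative integrand has the explicit primitive
  \<open>(u / (1 + u)) powr a / a\<close>, which increases from 0 to \<open>1 / a\<close>.\<close>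

lemma set_integrable_powr_Ioi:
  fixes a :: real
  assumes "a > 0"
  shows "set_integrable lborel {0<..} (\<lambda>u. u powr (a - 1) * (1 + u) powr (- (a + 1)))"
proof -
  have "set_integrable lborel (einterval 0 \<infinity>) (\<lambda>u. u powr (a - 1) * (1 + u) powr (- (a + 1)))"
  proof (rule interval_integral_FTC_nonneg(1))
    show "((\<lambda>u. (u / (1 + u)) powr a / a) has_real_derivative u powr (a - 1) * (1 + u) powr (- (a + 1))) (at u)"
      if "0 < ereal u" for u
    proof -
      have u: "u > 0" using that by simp
      have "((\<lambda>u. u / (1 + u)) has_real_derivative 1 / (1 + u)\<^sup>2) (at u)"
        using u by (auto intro!: derivative_eq_intros simp: power2_eq_square)
      then have "((\<lambda>u. (u / (1 + u)) powr a / a) has_real_derivative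
          a * (u / (1 + u)) powr (a - of_nat 1) * (1 / (1 + u)\<^sup>2) / a) (at u)"
        using u by (intro DERIV_cdivide DERIV_fun_powr) auto
      moreover have "(1 + u) powr (- (a + 1)) = 1 / ((1 + u) powr (a - 1) * (1 + u)\<^sup>2)"
      proof -
        have e: "- (a + 1) = - (a - 1) + (- 2)" by simp
        show ?thesis
          unfolding e powr_add powr_minus_divide using u powr_realpow[of "1 + u" 2] by simp
      qed
      ultimately show ?thesis
        using u assms by (simp add: powr_divide)
    qed
    show "isCont (\<lambda>u. u powr (a - 1) * (1 + u) powr (- (a + 1))) u" if "0 < ereal u" for u
      using that by (intro continuous_intros) auto
    have "((\<lambda>u::real. (u / (1 + u)) powr a / a) \<longlongrightarrow> (0 / (1 + 0)) powr a / a) (at_right 0)"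
      using assms by (intro tendsto_intros) (auto simp: eventually_at_filter intro!: always_eventually)
    then show "(((\<lambda>u. (u / (1 + u)) powr a / a) \<circ> real_of_ereal) \<longlongrightarrow> 0) (at_right 0)"
      using assms by (simp add: ereal_tendsto_simps zero_ereal_def)
    have "((\<lambda>u::real. u / (1 + u)) \<longlongrightarrow> 1) at_top" by real_asymp
    then have "((\<lambda>u::real. (u / (1 + u)) powr a / a) \<longlongrightarrow> 1 powr a / a) at_top"
      using assms by (intro tendsto_intros) auto
    then show "(((\<lambda>u. (u / (1 + u)) powr a / a) \<circ> real_of_ereal) \<longlongrightarrow> 1 / a) (at_left \<infinity>)"
      by (simp add: ereal_tendsto_simps)
  qed auto
  moreover have "einterval 0 \<infinity> = {0<..}" by (auto simp: einterval_def)
  ultimately show ?thesis by simp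
qed

text \<open>Prepares the integration by parts for the entropy: the boundary terms enter as limits at
  0 and at infinity.\<close>

lemma integral_FTC_Ioi:
  fixes f F :: "real \<Rightarrow> real"
  assumes F: "\<And>x. 0 < x \<Longrightarrow> (F has_real_derivative f x) (at x)"
    and f: "\<And>x. 0 < x \<Longrightarrow> isCont f x"
    and int: "set_integrable lborel {0<..} f"
    and A: "(F \<longlongrightarrow> A) (at_right 0)" and B: "(F \<longlongrightarrow> B) at_top"
  shows "(LBINT x:{0<..}. f x) = B - A"
proof -
  have e: "einterval 0 \<infinity> = {0<..}" by (auto simp: einterval_def)
  have "(LBINT x=0..\<infinity>. f x) = B - A"
  proof (rule interval_integral_FTC_integrable)
    show "((F \<circ> real_of_ereal) \<longlongrightarrow> A) (at_right 0)"
      using A by (simp add: ereal_tendsto_simps zero_ereal_def)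
    show "((F \<circ> real_of_ereal) \<longlongrightarrow> B) (at_left \<infinity>)"
      using B by (simp add: ereal_tendsto_simps)
  qed (use F f int e in \<open>auto simp: has_real_derivative_iff_has_vector_derivative\<close>)
  then show ?thesis
    by (simp add: interval_lebesgue_integral_def e)
qed

text \<open>The exponent is \<open>-(sqrt (b u) - sqrt (r x))\<^sup>2\<close> with \<open>b = lam + r\<close>; for \<open>x \<le> u\<close> it is at most
  \<open>-(sqrt b - sqrt r)\<^sup>2 u\<close>, for \<open>u < x\<close> the fraction exceeds 1.\<close>
lemma kernel_envelope:
  fixes lam p R :: real
  assumes lam: "lam > 0" and p: "p > 0"
  shows "\<exists>C>0. \<forall>r u x. 0 < r \<longrightarrow> r \<le> R \<longrightarrow> 0 < u \<longrightarrow> 0 < x \<longrightarrow>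
    exp (- (lam + r) * u - r * x + 2 * sqrt (r * (lam + r) * u * x)) \<le> C * ((1 + x) / (1 + u)) powr p"
proof -
  \<comment> \<open>A lower bound for \<open>(sqrt (lam + r) - sqrt r)\<^sup>2\<close> uniform in
    \<open>r \<le> R\<close>: this difference of roots times their sum is \<open>lam\<close>, and
    the sum is at most \<open>2 * sqrt (lam + \<bar>R\<bar>)\<close>. The absolute value keeps
    \<open>d\<close> positive for every \<open>R\<close>.\<close>
  define d where "d = lam\<^sup>2 / (4 * (lam + \<bar>R\<bar>))"
  have d: "d > 0" unfolding d_def using lam by (simp add: add_pos_nonneg)
  \<comment> \<open>The 1 covers \<open>u < x\<close>, where the exponential is at most 1; the other
    entry is \<open>powr_le_exp\<close> at \<open>1 + u\<close> with rate \<open>d\<close>.\<close>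
  define C where "C = max 1 ((p / d) powr p * exp d)"
  have C: "C \<ge> 1" "C \<ge> (p / d) powr p * exp d" by (auto simp: C_def)
  have "exp (- (lam + r) * u - r * x + 2 * sqrt (r * (lam + r) * u * x)) \<le> C * ((1 + x) / (1 + u)) powr p"
    if r: "0 < r" "r \<le> R" and u: "0 < u" and x: "0 < x" for r u x
  proof -
    let ?b = "lam + r"
    have ex: "- ?b * u - r * x + 2 * sqrt (r * ?b * u * x) = - (sqrt (?b * u) - sqrt (r * x))\<^sup>2"
    proof -
      have "(sqrt (?b * u))\<^sup>2 = ?b * u" "(sqrt (r * x))\<^sup>2 = r * x"
        using r u x lam by simp_all
      moreover have "sqrt (r * ?b * u * x) = sqrt (?b * u) * sqrt (r * x)"
        by (simp add: real_sqrt_mult [symmetric] mult_ac)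
      ultimately show ?thesis by (simp add: power2_diff algebra_simps)
    qed
    show ?thesis
    proof (cases "x \<le> u")
      case True
      have le: "sqrt r * sqrt x \<le> sqrt r * sqrt u" using True r by simp
      have sb: "sqrt r < sqrt ?b" using lam by simp
      have "(sqrt ?b - sqrt r) * (sqrt ?b + sqrt r) = lam"
        using r lam by (simp add: algebra_simps)
      moreover have "sqrt ?b \<le> sqrt (lam + \<bar>R\<bar>)"
        using r by (intro real_sqrt_le_mono) auto
      then have "sqrt ?b + sqrt r \<le> 2 * sqrt (lam + \<bar>R\<bar>)"
        using sb by linarith
      ultimately have "lam \<le> (sqrt ?b - sqrt r) * (2 * sqrt (lam + \<bar>R\<bar>))"
        using sb by (metis diff_ge_0_iff_ge less_imp_le mult_left_mono)
      then have "lam\<^sup>2 \<le> ((sqrt ?b - sqrt r) * (2 * sqrt (lam + \<bar>R\<bar>)))\<^sup>2"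
        using lam by (intro power_mono) auto
      then have "d \<le> (sqrt ?b - sqrt r)\<^sup>2"
        using lam by (simp add: d_def power_mult_distrib divide_le_eq add_pos_nonneg mult_ac
            del: distrib_left_numeral distrib_right_numeral)
      then have "d * u \<le> ((sqrt ?b - sqrt r) * sqrt u)\<^sup>2"
        using u by (simp add: power_mult_distrib)
      also have "\<dots> \<le> (sqrt (?b * u) - sqrt (r * x))\<^sup>2"
        unfolding real_sqrt_mult using le sb u by (intro power_mono) (simp_all add: left_diff_distrib)
      finally have "exp (- ?b * u - r * x + 2 * sqrt (r * ?b * u * x)) \<le> exp (- d * u)"
        unfolding ex by simp
      also have "\<dots> \<le> C * (1 / (1 + u)) powr p"
      proof -
        have "(1 + u) powr p \<le> (p / d) powr p * exp d * exp (d * u)"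
          using powr_le_exp[OF p d, of "1 + u"] u by (simp add: distrib_left exp_add mult_ac)
        also have "\<dots> \<le> C * exp (d * u)" using C by simp
        finally show ?thesis
          using u by (simp add: powr_divide exp_minus field_simps)
      qed
      also have "\<dots> \<le> C * ((1 + x) / (1 + u)) powr p"
        using C u x p by (intro mult_left_mono powr_mono2 divide_right_mono) auto
      finally show ?thesis .
    next
      case False
      have "1 * 1 \<le> C * ((1 + x) / (1 + u)) powr p"
        using C u False p by (intro mult_mono ge_one_powr_ge_zero) auto
      then show ?thesis unfolding ex using exp_le_one_iff[of "- (sqrt (?b * u) - sqrt (r * x))\<^sup>2"] by (smt (verit) zero_le_power2)
    qed
  qed
  then show ?thesis using C(1) by (intro exI[of _ C]) auto
qed

subsection \<open>Mixtures of the kernel\<close>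

locale gamma_mixing = prob_space P for P :: "real measure" +
  fixes a lam :: real
  assumes a: "a \<ge> 1/2" and lam: "lam > 0"
    and sets_P [measurable_cong]: "sets P = sets borel"
    and pos: "AE x in P. x > 0"
    and moment: "integrable P (\<lambda>x. x powr (a + 4))"
begin

text \<open>\<open>i\<close> shifts the parameter and \<open>j\<close> counts powers of
  \<open>x\<close>. Differentiation in \<open>c\<close> raises both by one, so the family is closed
  under it. The argument \<open>c\<close> is later set to \<open>r * (lam + r) * u\<close>.\<close>

definition T :: "nat \<Rightarrow> nat \<Rightarrow> real \<Rightarrow> real \<Rightarrow> real" where
  "T i j r c = (LINT x|P. x ^ j * exp (- r * x) * hyp01 (a + i) (c * x))"

text \<open>Half of the rate \<open>r1\<close> absorbs \<open>x ^ j\<close> through one term of the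
  exponential series; the other half pays for \<open>exp (2 * sqrt (c * x))\<close> by the
  arithmetic-geometric mean inequality. The bound is free of \<open>x\<close>, so constants can
  dominate under \<open>P\<close>.\<close>

lemma T_integrand_bounds:
  assumes "0 < r1" "r1 \<le> r" "0 \<le> c" "c \<le> C" "0 < x"
  shows "0 < x ^ j * exp (- r * x) * hyp01 (a + real i) (c * x)"
    and "x ^ j * exp (- r * x) * hyp01 (a + real i) (c * x) \<le> fact j * (2 / r1) ^ j * exp (2 * C / r1)"
proof -
  have cx: "0 \<le> c * x" using assms by simp
  have ai: "a + real i \<ge> 1/2" using a by simp
  show "0 < x ^ j * exp (- r * x) * hyp01 (a + real i) (c * x)"
    using hyp01_ge_1[OF ai cx] assms by simp
  have "(r1 * x / 2) ^ j / fact j \<le> exp (r1 * x / 2)"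
    using assms power_over_fact_le_exp[of "r1 * x / 2" j] by simp
  then have 1: "x ^ j \<le> fact j * (2 / r1) ^ j * exp (r1 * x / 2)"
    using assms by (simp add: power_mult_distrib power_divide field_simps)
  have "2 * sqrt (c * x) \<le> 2 * (sqrt (r1 * x / 2) * sqrt (2 * C / r1))"
    using assms by (simp add: real_sqrt_mult[symmetric] mult_right_mono)
  also have "\<dots> \<le> r1 * x / 2 + 2 * C / r1"
    using arith_geo_mean_sqrt[of "r1 * x / 2" "2 * C / r1"] assms
      real_sqrt_mult[of "r1 * x / 2" "2 * C / r1"] by simp
  finally have 2: "exp (2 * sqrt (c * x)) \<le> exp (r1 * x / 2 + 2 * C / r1)" by simp
  have "exp (- r * x) * hyp01 (a + real i) (c * x) \<le> exp (- r1 * x) * exp (r1 * x / 2 + 2 * C / r1)"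
    using assms order_trans[OF hyp01_le_exp[OF ai cx] 2] hyp01_ge_1[OF ai cx]
    by (intro mult_mono) auto
  also have "\<dots> = exp (- (r1 * x / 2)) * exp (2 * C / r1)"
    by (simp add: exp_add [symmetric])
  finally have 3: "exp (- r * x) * hyp01 (a + real i) (c * x) \<le> exp (- (r1 * x / 2)) * exp (2 * C / r1)" .
  have "x ^ j * (exp (- r * x) * hyp01 (a + real i) (c * x)) \<le>
      (fact j * (2 / r1) ^ j * exp (r1 * x / 2)) * (exp (- (r1 * x / 2)) * exp (2 * C / r1))"
    by (rule mult_mono) (use 1 3 assms hyp01_ge_1[OF ai cx] in auto)
  then show "x ^ j * exp (- r * x) * hyp01 (a + real i) (c * x) \<le> fact j * (2 / r1) ^ j * exp (2 * C / r1)"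
    by (simp add: exp_minus field_simps)
qed

lemma measurable_T_integrand [measurable]:
  "(\<lambda>x. x ^ j * exp (- r * x) * hyp01 (a + real i) (c * x)) \<in> borel_measurable P"
  by measurable (use a in auto)

lemma integrable_T:
  assumes "0 < r" "0 \<le> c"
  shows "integrable P (\<lambda>x. x ^ j * exp (- r * x) * hyp01 (a + real i) (c * x))"
proof (rule integrable_const_bound)
  show "AE x in P. norm (x ^ j * exp (- r * x) * hyp01 (a + real i) (c * x)) \<le> fact j * (2 / r) ^ j * exp (2 * c / r)"
    using pos by eventually_elim
      (use T_integrand_bounds[OF assms(1) order.refl assms(2) order.refl, of _ j i] in force)
qed measurable

lemma T_nonneg: "0 < r \<Longrightarrow> 0 \<le> c \<Longrightarrow> 0 \<le> T i j r c"
  unfolding T_def using pos T_integrand_bounds(1)[of r r c c _ j i]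
  by (intro integral_nonneg_AE) (auto elim!: eventually_mono intro: less_imp_le)

lemma T_antimono_param:
  assumes "0 < r" "0 \<le> c"
  shows "T (Suc i) j r c \<le> T i j r c"
  unfolding T_def
proof (rule integral_mono_AE[OF integrable_T integrable_T])
  show "AE x in P. x ^ j * exp (- r * x) * hyp01 (a + real (Suc i)) (c * x) \<le> x ^ j * exp (- r * x) * hyp01 (a + real i) (c * x)"
    using pos
  proof eventually_elim
    case (elim x)
    then show ?case
      using a assms by (intro mult_left_mono hyp01_mono_param) auto
  qed
qed (use assms in auto)

lemma exp_moment_pos: "0 < (LINT x|P. exp (- r * x))" if "0 < r"
proof -
  have "integrable P (\<lambda>x. exp (- r * x))"
    by (rule integrable_const_bound[of _ 1]) (use pos that in \<open>auto elim!: eventually_mono\<close>)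
  then show ?thesis
    by (rule expectation_greater) auto
qed

text \<open>As \<open>hyp01 \<ge> 1\<close>, the exponential moment at rate \<open>R\<close> is a
  floor independent of \<open>c\<close> and \<open>r\<close>; it later bounds
  \<open>ln (h r u)\<close> from below.\<close>

lemma T00_ge:
  assumes "0 < r" "r \<le> R" "0 \<le> c"
  shows "(LINT x|P. exp (- R * x)) \<le> T 0 0 r c"
  unfolding T_def
proof (rule integral_mono_AE)
  show "integrable P (\<lambda>x. exp (- R * x))"
    by (rule integrable_const_bound[of _ 1]) (use pos assms in \<open>auto elim!: eventually_mono\<close>)
  show "AE x in P. exp (- R * x) \<le> x ^ 0 * exp (- r * x) * hyp01 (a + real 0) (c * x)"
    using pos
  proof eventually_elim
    case (elim x)
    have "exp (- R * x) * 1 \<le> exp (- r * x) * hyp01 a (c * x)"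
      using elim assms a by (intro mult_mono hyp01_ge_1) auto
    then show ?case by simp
  qed
qed (rule integrable_T, use assms in auto)

lemma T00_pos: "0 < r \<Longrightarrow> 0 \<le> c \<Longrightarrow> 0 < T 0 0 r c"
  using T00_ge[of r r c] exp_moment_pos[of r] by simp

text \<open>Cauchy--Schwarz, as nonnegativity of the variance of the tilted measure.\<close>
lemma T_Cauchy_Schwarz:
  assumes "0 < r" "0 \<le> c"
  shows "(T 0 1 r c)\<^sup>2 \<le> T 0 0 r c * T 0 2 r c"
proof -
  \<comment> \<open>The mean of the tilted measure; the integral below is its unnormalised
    variance.\<close>
  define m where "m = T 0 1 r c / T 0 0 r c"
  let ?k = "\<lambda>j x. x ^ j * exp (- r * x) * hyp01 (a + real 0) (c * x)"
  note I = integrable_T[OF assms, of _ 0]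
  have "0 \<le> (LINT x|P. (?k 2 x - 2 * m * ?k 1 x) + m\<^sup>2 * ?k 0 x)"
  proof (rule integral_nonneg_AE)
    show "AE x in P. 0 \<le> (?k 2 x - 2 * m * ?k 1 x) + m\<^sup>2 * ?k 0 x"
      using pos
    proof eventually_elim
      case (elim x)
      have "(?k 2 x - 2 * m * ?k 1 x) + m\<^sup>2 * ?k 0 x = (x - m)\<^sup>2 * ?k 0 x"
        by (simp add: power2_eq_square algebra_simps)
      also have "\<dots> \<ge> 0"
        by (rule mult_nonneg_nonneg[OF zero_le_power2 less_imp_le[OF T_integrand_bounds(1)[of r r c c]]])
          (use assms elim in auto)
      finally show ?case .
    qed
  qed
  also have "\<dots> = T 0 2 r c - 2 * m * T 0 1 r c + m\<^sup>2 * T 0 0 r c"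
    unfolding T_def
    by (subst Bochner_Integration.integral_add Bochner_Integration.integral_diff, (intro integrable_mult_right Bochner_Integration.integrable_diff I)+)+
      (simp only: integral_mult_right_zero)
  also have "\<dots> = T 0 2 r c - (T 0 1 r c)\<^sup>2 / T 0 0 r c"
    using T00_pos[OF assms] by (simp add: m_def power2_eq_square field_simps)
  finally show ?thesis
    using T00_pos[OF assms] by (simp add: field_simps)
qed

section \<open>Derivatives of the mixtures\<close>

lemma has_real_derivative_T:
  assumes "0 < r" "0 < c"
  shows "(T i j r has_real_derivative T (Suc i) (Suc j) r c / (a + i)) (at c)"
proof -
  let ?k = "\<lambda>i j c x. x ^ j * exp (- r * x) * hyp01 (a + real i) (c * x)"
  have "((\<lambda>c. LINT x|P. ?k i j c x) has_real_derivative (LINT x|P. ?k (Suc i) (Suc j) c x / (a + i))) (at c)"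
  \<comment> \<open>On this neighbourhood of \<open>c\<close> the argument stays below
    \<open>2 * c\<close>, so \<open>T_integrand_bounds\<close> supplies a constant majorant.\<close>
  proof (rule has_real_derivative_integral(1)[where l = 0 and R = "2 * c" and
      B = "\<lambda>x. fact (Suc j) * (2 / r) ^ Suc j * exp (2 * (2 * c) / r) / (a + i)"])
    show "AE x in P. \<forall>s\<in>{0<..<2 * c}. ((\<lambda>c. ?k i j c x) has_real_derivative ?k (Suc i) (Suc j) s x / (a + i)) (at s)
        \<and> \<bar>?k (Suc i) (Suc j) s x / (a + i)\<bar> \<le> fact (Suc j) * (2 / r) ^ Suc j * exp (2 * (2 * c) / r) / (a + i)"
      using pos
    proof (eventually_elim, intro ballI conjI)
      fix x s :: real assume xs: "0 < x" "s \<in> {0<..<2 * c}"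
      have "((\<lambda>c. hyp01 (a + real i) (c * x)) has_real_derivative (hyp01 (a + real i + 1) (s * x) / (a + i)) * x) (at s)"
        by (rule DERIV_chain2[OF has_real_derivative_hyp01]) (use a in \<open>auto intro!: derivative_eq_intros\<close>)
      from DERIV_cmult[OF this, of "x ^ j * exp (- r * x)"]
      show "((\<lambda>c. ?k i j c x) has_real_derivative ?k (Suc i) (Suc j) s x / (a + i)) (at s)"
        by (simp add: mult_ac add_ac)
      show "\<bar>?k (Suc i) (Suc j) s x / (a + i)\<bar> \<le> fact (Suc j) * (2 / r) ^ Suc j * exp (2 * (2 * c) / r) / (a + i)"
        using T_integrand_bounds[of r r s "2 * c" x "Suc j" "Suc i"] xs assms a
        by (simp only: abs_divide) (intro divide_right_mono frac_le, auto)
    qed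
    show "integrable P (?k i j s)" if "s \<in> {0<..<2 * c}" for s
      using integrable_T[of r s j i] that assms by simp
    show "(\<lambda>x. ?k (Suc i) (Suc j) c x / (a + i)) \<in> borel_measurable P"
      by (intro borel_measurable_divide measurable_T_integrand borel_measurable_const)
  qed (use assms in auto)
  then show ?thesis
    by (simp add: T_def[abs_def])
qed

text \<open>Both arguments of \<open>T\<close> move with \<open>r\<close>: the factor
  \<open>exp (- r * x)\<close> yields \<open>T 0 1\<close>, and \<open>lam + 2 * r\<close> is the
  derivative of \<open>r * (lam + r)\<close>.\<close>

lemma has_real_derivative_T00_path:
  assumes "0 < r" "0 < u"
  shows "((\<lambda>r. T 0 0 r (r * (lam + r) * u)) has_real_derivative
    - T 0 1 r (r * (lam + r) * u) + (lam + 2 * r) * u / a * T 1 1 r (r * (lam + r) * u)) (at r)"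
proof -
  let ?c = "\<lambda>r. r * (lam + r) * u"
  let ?k = "\<lambda>i j r x. x ^ j * exp (- r * x) * hyp01 (a + real i) (?c r * x)"
  let ?k' = "\<lambda>r x. - ?k 0 1 r x + (lam + 2 * r) * u / a * ?k 1 1 r x"
  \<comment> \<open>The bound of \<open>T_integrand_bounds\<close> for \<open>j = 1\<close> on the
    interval from \<open>r / 2\<close> to \<open>2 * r\<close>: the rate is smallest at the left
    end, \<open>?c\<close> largest at the right end.\<close>
  let ?M = "fact 1 * (2 / (r / 2)) ^ 1 * exp (2 * ?c (2 * r) / (r / 2))"
  have c: "0 < ?c s" if "0 < s" for s using that lam assms by simp
  have "((\<lambda>r. LINT x|P. ?k 0 0 r x) has_real_derivative (LINT x|P. ?k' r x)) (at r)"
  proof (rule has_real_derivative_integral(1)[where l = "r / 2" and R = "2 * r" and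
      B = "\<lambda>x. ?M + (lam + 2 * (2 * r)) * u / a * ?M"])
    show "AE x in P. \<forall>s\<in>{r / 2<..<2 * r}. ((\<lambda>r. ?k 0 0 r x) has_real_derivative ?k' s x) (at s)
        \<and> \<bar>?k' s x\<bar> \<le> ?M + (lam + 2 * (2 * r)) * u / a * ?M"
      using pos
    proof (eventually_elim, intro ballI conjI)
      fix x s :: real assume xs: "0 < x" "s \<in> {r / 2<..<2 * r}"
      have "((\<lambda>r. hyp01 a (?c r * x)) has_real_derivative (hyp01 (a + 1) (?c s * x) / a) * ((lam + 2 * s) * u * x)) (at s)"
        by (rule DERIV_chain2[OF has_real_derivative_hyp01[OF a]]) (auto intro!: derivative_eq_intros simp: algebra_simps)
      moreover have "((\<lambda>r. exp (- r * x)) has_real_derivative - x * exp (- s * x)) (at s)"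
        by (auto intro!: derivative_eq_intros)
      ultimately have "((\<lambda>r. exp (- r * x) * hyp01 a (?c r * x)) has_real_derivative
          (- x * exp (- s * x)) * hyp01 a (?c s * x) + (hyp01 (a + 1) (?c s * x) / a) * ((lam + 2 * s) * u * x) * exp (- s * x)) (at s)"
        by (rule DERIV_mult[rotated])
      then show "((\<lambda>r. ?k 0 0 r x) has_real_derivative ?k' s x) (at s)"
        by (simp add: mult_ac)
      have cs: "?c s \<le> ?c (2 * r)"
        using xs lam assms by (intro mult_mono) auto
      have k: "0 < ?k i 1 s x" for i
        by (rule T_integrand_bounds(1)[of s s "?c s" "?c s"]) (use c[of s] xs assms in auto)
      have kM: "?k i 1 s x \<le> ?M" for i
        by (rule T_integrand_bounds(2)) (use c[of s] cs xs assms in auto)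
      have q: "0 \<le> (lam + 2 * s) * u / a" "(lam + 2 * s) * u / a \<le> (lam + 2 * (2 * r)) * u / a"
        using xs assms a lam by (auto intro!: divide_right_mono mult_right_mono)
      have "\<bar>?k' s x\<bar> \<le> \<bar>?k 0 1 s x\<bar> + \<bar>(lam + 2 * s) * u / a * ?k 1 1 s x\<bar>"
        using abs_triangle_ineq[of "- ?k 0 1 s x" "(lam + 2 * s) * u / a * ?k 1 1 s x"]
        by (simp only: abs_minus_cancel)
      also have "\<dots> = ?k 0 1 s x + (lam + 2 * s) * u / a * ?k 1 1 s x"
      proof -
        have "0 \<le> (lam + 2 * s) * u / a * ?k 1 1 s x"
          by (rule mult_nonneg_nonneg[OF q(1) less_imp_le[OF k]])
        then show ?thesis
          by (simp only: abs_of_pos[OF k] abs_of_nonneg)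
      qed
      also have "\<dots> \<le> ?M + (lam + 2 * (2 * r)) * u / a * ?M"
        by (intro add_mono[OF kM mult_mono[OF q(2) kM]] order_trans[OF q] less_imp_le[OF k])
      finally show "\<bar>?k' s x\<bar> \<le> ?M + (lam + 2 * (2 * r)) * u / a * ?M" .
    qed
    show "integrable P (?k 0 0 s)" if "s \<in> {r / 2<..<2 * r}" for s
      using integrable_T[of s "?c s" 0 0] c[of s] that assms by simp
    show "?k' r \<in> borel_measurable P"
      by (intro borel_measurable_add borel_measurable_uminus borel_measurable_times measurable_T_integrand borel_measurable_const)
  qed (use assms in auto)
  also have "(LINT x|P. ?k' r x) = - T 0 1 r (?c r) + (lam + 2 * r) * u / a * T 1 1 r (?c r)"
    unfolding T_def integral_minus[symmetric] integral_mult_right_zero[symmetric]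
    using assms c[of r]
    by (intro Bochner_Integration.integral_add Bochner_Integration.integrable_minus integrable_mult_right integrable_T) auto
  finally show ?thesis
    by (simp add: T_def[abs_def])
qed

text \<open>The integrated form of \<open>hyp01_contiguous\<close>; through it the differential
  equation of \<open>hyp01\<close> reaches the heat equation for \<open>h\<close>.\<close>

lemma T_contiguous:
  assumes "0 < r" "0 < c"
  shows "T 0 1 r c = T 1 1 r c + c / (a * (a + 1)) * T 2 2 r c"
proof -
  have "x ^ 1 * exp (- r * x) * hyp01 (a + real 0) (c * x) = x ^ 1 * exp (- r * x) * hyp01 (a + real 1) (c * x)
      + c / (a * (a + 1)) * (x ^ 2 * exp (- r * x) * hyp01 (a + real 2) (c * x))" for x
    using hyp01_contiguous[OF a, of "c * x"] by (simp add: power2_eq_square algebra_simps add_divide_distrib)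
  then show ?thesis
    unfolding T_def integral_mult_right_zero[symmetric] using assms
    by (simp only:) (intro Bochner_Integration.integral_add integrable_mult_right integrable_T, auto)
qed

section \<open>Decay in \<open>u\<close> from the moment of the mixing law\<close>

lemma integrable_shifted_moment:
  assumes "q \<le> a + 4" "0 \<le> q"
  shows "integrable P (\<lambda>x. (1 + x) powr q)"
proof (rule Bochner_Integration.integrable_bound)
  show "integrable P (\<lambda>x. 2 powr (a + 4) * (1 + x powr (a + 4)))"
    using moment by simp
  show "AE x in P. norm ((1 + x) powr q) \<le> norm (2 powr (a + 4) * (1 + x powr (a + 4)))"
    using pos
  proof eventually_elim
    case (elim x)
    have "(1 + x) powr q \<le> (1 + x) powr (a + 4)"
      using elim assms by (intro powr_mono) auto
    also have "\<dots> \<le> (2 * max 1 x) powr (a + 4)"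
      using elim a by (intro powr_mono2) auto
    also have "\<dots> = 2 powr (a + 4) * (max 1 x) powr (a + 4)"
      by (rule powr_mult)
    also have "(max 1 x) powr (a + 4) \<le> 1 + x powr (a + 4)"
      by (auto simp: max_def)
    finally show ?case by simp
  qed
qed measurable

text \<open>The bound \<open>hyp01 \<le> exp (2 * sqrt z)\<close> holds for every parameter
  \<open>a + i\<close>, so \<open>kernel_envelope\<close> gives a constant independent of
  \<open>i\<close>.\<close>

lemma T_decay:
  fixes j :: nat
  assumes "j \<le> 2"
  shows "\<exists>C>0. \<forall>i r u. 0 < r \<longrightarrow> r \<le> R \<longrightarrow> 0 < u \<longrightarrow>
    exp (- (lam + r) * u) * T i j r (r * (lam + r) * u) \<le> C * (1 + u) powr (- (a + 4 - j))"
proof -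
  \<comment> \<open>Chosen so that \<open>x ^ j\<close> and the envelope's
    \<open>(1 + x) powr p\<close> together spend exactly the moment of order
    \<open>a + 4\<close>.\<close>
  define p where "p = a + 4 - real j"
  have p: "p > 0" "p + j = a + 4" using a assms by (auto simp: p_def)
  obtain C where C: "C > 0" and env: "\<And>r u x. 0 < r \<Longrightarrow> r \<le> R \<Longrightarrow> 0 < u \<Longrightarrow> 0 < x \<Longrightarrow>
      exp (- (lam + r) * u - r * x + 2 * sqrt (r * (lam + r) * u * x)) \<le> C * ((1 + x) / (1 + u)) powr p"
    using kernel_envelope[OF lam p(1), of R] by blast
  define E where "E = (LINT x|P. (1 + x) powr (a + 4))"
  have E: "E \<ge> 0" unfolding E_def by (intro integral_nonneg_AE) auto
  have "exp (- (lam + r) * u) * T i j r (r * (lam + r) * u) \<le> C * (E + 1) * (1 + u) powr (- p)"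
    if r: "0 < r" "r \<le> R" and u: "0 < u" for i r u
  proof -
    let ?c = "r * (lam + r) * u"
    have c: "0 < ?c" using r u lam by simp
    have "exp (- (lam + r) * u) * T i j r ?c \<le> (LINT x|P. C * (1 + u) powr (- p) * (1 + x) powr (a + 4))"
      unfolding T_def integral_mult_right_zero[symmetric]
    proof (rule integral_mono_AE)
      show "AE x in P. exp (- (lam + r) * u) * (x ^ j * exp (- r * x) * hyp01 (a + real i) (?c * x))
          \<le> C * (1 + u) powr (- p) * (1 + x) powr (a + 4)"
        using pos
      proof eventually_elim
        case (elim x)
        have "exp (- (lam + r) * u) * (x ^ j * exp (- r * x) * hyp01 (a + real i) (?c * x))
            \<le> exp (- (lam + r) * u) * (x ^ j * exp (- r * x) * exp (2 * sqrt (?c * x)))"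
          using elim c a by (intro mult_left_mono hyp01_le_exp) auto
        also have "\<dots> = x ^ j * exp (- (lam + r) * u - r * x + 2 * sqrt (?c * x))"
          by (simp add: exp_add exp_diff exp_minus field_simps)
        also have "\<dots> \<le> (1 + x) ^ j * (C * ((1 + x) / (1 + u)) powr p)"
          using elim env[OF r u elim] by (intro mult_mono power_mono) auto
        also have "\<dots> = C * (1 + u) powr (- p) * ((1 + x) powr p * (1 + x) powr j)"
          using elim u by (simp add: powr_divide powr_minus powr_realpow field_simps)
        also have "(1 + x) powr p * (1 + x) powr j = (1 + x) powr (a + 4)"
          by (simp add: powr_add[symmetric] p)
        finally show ?case .
      qed
    qed (use integrable_T[of r ?c j i] integrable_shifted_moment[of "a + 4"] r c a in auto)
    also have "\<dots> = C * (1 + u) powr (- p) * E"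
      by (simp add: E_def)
    also have "\<dots> \<le> C * (E + 1) * (1 + u) powr (- p)"
      using C by (simp add: algebra_simps)
    finally show ?thesis .
  qed
  then show ?thesis
    using C E by (intro exI[of _ "C * (E + 1)"]) (auto simp: p_def)
qed

subsection \<open>The relative density and its bounds\<close>

lemma continuous_on_T [continuous_intros]:
  assumes "0 < r" "continuous_on S f" "\<And>x. x \<in> S \<Longrightarrow> 0 < f x"
  shows "continuous_on S (\<lambda>x. T i j r (f x))"
proof (rule continuous_on_compose2[OF _ assms(2)])
  show "continuous_on {0<..} (T i j r)"
    by (intro continuous_at_imp_continuous_on ballI DERIV_isCont[OF has_real_derivative_T[OF assms(1)]]) auto
qed (use assms(3) in auto)

definition h :: "real \<Rightarrow> real \<Rightarrow> real" where
  "h r u = ((lam + r) / lam) powr a * exp (- r * u) * T 0 0 r (r * (lam + r) * u)"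

text \<open>Like \<open>h_r\<close> below, a partial derivative of \<open>h\<close> in closed form,
  so that continuity and bounds can be inherited from \<open>T\<close>.\<close>

definition h_u :: "real \<Rightarrow> real \<Rightarrow> real" where
  "h_u r u = ((lam + r) / lam) powr a * exp (- r * u) *
     (r * (lam + r) / a * T 1 1 r (r * (lam + r) * u) - r * T 0 0 r (r * (lam + r) * u))"

definition h_r :: "real \<Rightarrow> real \<Rightarrow> real" where
  "h_r r u = ((lam + r) / lam) powr a * exp (- r * u) *
     ((a / (lam + r) - u) * T 0 0 r (r * (lam + r) * u) - T 0 1 r (r * (lam + r) * u)
       + (lam + 2 * r) * u / a * T 1 1 r (r * (lam + r) * u))"

lemma h_pos: "0 < r \<Longrightarrow> 0 < u \<Longrightarrow> 0 < h r u"
  using lam T00_pos[of r "r * (lam + r) * u"] by (simp add: h_def)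

lemma gamma_dens_pos: "0 < u \<Longrightarrow> 0 < gamma_dens a lam u"
  using lam a by (simp add: gamma_dens_def Gamma_real_pos)

lemma has_real_derivative_gamma_dens:
  assumes "0 < u"
  shows "(gamma_dens a lam has_real_derivative gamma_dens a lam u * ((a - 1) / u - lam)) (at u)"
proof -
  have 1: "((\<lambda>u. u powr (a - 1)) has_real_derivative (a - 1) / u * u powr (a - 1)) (at u)"
    using assms has_real_derivative_powr[of u "a - 1"] powr_diff[of u "a - 1" 1] by simp
  have 2: "((\<lambda>u. exp (- lam * u)) has_real_derivative - lam * exp (- lam * u)) (at u)"
    by (auto intro!: derivative_eq_intros)
  have "((\<lambda>u. lam powr a / Gamma a * u powr (a - 1) * exp (- lam * u)) has_real_derivative
      lam powr a / Gamma a * ((a - 1) / u * u powr (a - 1)) * exp (- lam * u)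
      + - lam * exp (- lam * u) * (lam powr a / Gamma a * u powr (a - 1))) (at u)"
    by (rule DERIV_mult[OF DERIV_cmult[OF 1] 2])
  moreover have "lam powr a / Gamma a * ((a - 1) / u * u powr (a - 1)) * exp (- lam * u)
      + - lam * exp (- lam * u) * (lam powr a / Gamma a * u powr (a - 1)) = gamma_dens a lam u * ((a - 1) / u - lam)"
    by (simp add: gamma_dens_def right_diff_distrib diff_divide_distrib mult_ac)
  ultimately show ?thesis
    by (simp add: gamma_dens_def[abs_def])
qed

lemma has_real_derivative_T_scaled:
  assumes "0 < r" "0 < u"
  shows "((\<lambda>u. T i j r (r * (lam + r) * u)) has_real_derivative
    r * (lam + r) / (a + i) * T (Suc i) (Suc j) r (r * (lam + r) * u)) (at u)"
proof -
  have "((\<lambda>u. T i j r (r * (lam + r) * u)) has_real_derivative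
    T (Suc i) (Suc j) r (r * (lam + r) * u) / (a + i) * (r * (lam + r))) (at u)"
    by (rule DERIV_chain2[OF has_real_derivative_T]) (use assms lam in \<open>auto intro!: derivative_eq_intros\<close>)
  then show ?thesis by (simp add: mult_ac)
qed

lemma has_real_derivative_h:
  assumes "0 < r" "0 < u"
  shows "(h r has_real_derivative h_u r u) (at u)"
proof -
  have "((\<lambda>u. exp (- r * u)) has_real_derivative - r * exp (- r * u)) (at u)"
    by (auto intro!: derivative_eq_intros)
  from DERIV_cmult[OF DERIV_mult[OF this has_real_derivative_T_scaled[OF assms, of 0 0]], of "((lam + r) / lam) powr a"]
  show ?thesis
    by (simp add: h_def[abs_def] h_u_def algebra_simps)
qed

lemma has_real_derivative_h_path:
  assumes "0 < r" "0 < u"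
  shows "((\<lambda>r. h r u) has_real_derivative h_r r u) (at r)"
proof -
  have "((\<lambda>r. ((lam + r) / lam) powr a) has_real_derivative a * ((lam + r) / lam) powr (a - of_nat 1) * (1 / lam)) (at r)"
    using assms lam by (intro DERIV_fun_powr) (auto intro!: derivative_eq_intros)
  moreover have "((lam + r) / lam) powr (a - of_nat 1) * (1 / lam) = ((lam + r) / lam) powr a / (lam + r)"
    using assms lam by (simp add: powr_diff)
  ultimately have 1: "((\<lambda>r. ((lam + r) / lam) powr a) has_real_derivative a * (((lam + r) / lam) powr a / (lam + r))) (at r)"
    by (simp only: mult.assoc)
  have 2: "((\<lambda>r. exp (- r * u)) has_real_derivative - u * exp (- r * u)) (at r)"
    by (auto intro!: derivative_eq_intros)
  from DERIV_mult[OF DERIV_mult[OF 1 2] has_real_derivative_T00_path[OF assms]]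
  have "((\<lambda>r. h r u) has_real_derivative
      (a * (((lam + r) / lam) powr a / (lam + r)) * exp (- r * u) + - u * exp (- r * u) * ((lam + r) / lam) powr a) * T 0 0 r (r * (lam + r) * u)
      + (- T 0 1 r (r * (lam + r) * u) + (lam + 2 * r) * u / a * T 1 1 r (r * (lam + r) * u)) * (((lam + r) / lam) powr a * exp (- r * u))) (at r)"
    by (simp only: h_def)
  then show ?thesis
    by (rule DERIV_cong) (simp add: h_r_def left_diff_distrib right_diff_distrib distrib_left distrib_right mult_ac)
qed

text \<open>The heat equation \<open>h_r = -(u h_uu + (a - lam u) h_u) / (r (lam + r))\<close> of the Laguerre
  semigroup, in divergence form.\<close>
lemma has_real_derivative_flux:
  assumes "0 < r" "0 < u"
  shows "((\<lambda>u. gamma_dens a lam u * u * h_u r u) has_real_derivative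
    - (r * (lam + r)) * (gamma_dens a lam u * h_r r u)) (at u)"
proof -
  let ?q = "r * (lam + r)" and ?A = "((lam + r) / lam) powr a"
  let ?T = "\<lambda>i j. T i j r (?q * u)"
  \<comment> \<open>The \<open>u\<close>-derivative of the bracket in \<open>h_u\<close>.\<close>
  define D where "D = ?q / a * (?q / (a + 1) * ?T 2 2) - r * (?q / a * ?T 1 1)"
  have "((\<lambda>u. ?q / a * T 1 1 r (?q * u) - r * T 0 0 r (?q * u)) has_real_derivative D) (at u)"
    using DERIV_diff[OF DERIV_cmult[OF has_real_derivative_T_scaled[OF assms, of 1 1], of "?q / a"]
        DERIV_cmult[OF has_real_derivative_T_scaled[OF assms, of 0 0], of r]]
    by (simp add: D_def numeral_2_eq_2)
  moreover have "((\<lambda>u. ?A * exp (- r * u)) has_real_derivative - r * (?A * exp (- r * u))) (at u)"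
    by (auto intro!: derivative_eq_intros)
  ultimately have hu: "(h_u r has_real_derivative
      - r * (?A * exp (- r * u)) * (?q / a * ?T 1 1 - r * ?T 0 0) + D * (?A * exp (- r * u))) (at u)"
    unfolding h_u_def[abs_def] by (rule DERIV_mult[rotated])
  have "((\<lambda>u. gamma_dens a lam u * u) has_real_derivative
      gamma_dens a lam u * ((a - 1) / u - lam) * u + 1 * gamma_dens a lam u) (at u)"
    by (rule DERIV_mult[OF has_real_derivative_gamma_dens[OF assms(2)] DERIV_ident])
  moreover have "gamma_dens a lam u * ((a - 1) / u - lam) * u + 1 * gamma_dens a lam u = gamma_dens a lam u * (a - lam * u)"
    using assms by (simp add: field_simps)
  ultimately have "((\<lambda>u. gamma_dens a lam u * u) has_real_derivative gamma_dens a lam u * (a - lam * u)) (at u)"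
    by simp
  from DERIV_mult[OF this hu] have "((\<lambda>u. gamma_dens a lam u * u * h_u r u) has_real_derivative
      gamma_dens a lam u * (?A * exp (- r * u)) *
        ((a - lam * u) * (?q / a * ?T 1 1 - r * ?T 0 0) - u * r * (?q / a * ?T 1 1 - r * ?T 0 0) + u * D)) (at u)"
  proof (rule DERIV_cong)
    have "g * l * (E * V) + (- r * E * V + D * E) * (g * u) = g * E * (l * V - u * r * V + u * D)"
      for g l E V :: real by (simp add: algebra_simps)
    then show "gamma_dens a lam u * (a - lam * u) * h_u r u
        + (- r * (?A * exp (- r * u)) * (?q / a * ?T 1 1 - r * ?T 0 0) + D * (?A * exp (- r * u))) * (gamma_dens a lam u * u)
      = gamma_dens a lam u * (?A * exp (- r * u)) *
        ((a - lam * u) * (?q / a * ?T 1 1 - r * ?T 0 0) - u * r * (?q / a * ?T 1 1 - r * ?T 0 0) + u * D)"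
      unfolding h_u_def .
  qed
  moreover have "(a - lam * u) * (?q / a * ?T 1 1 - r * ?T 0 0) - u * r * (?q / a * ?T 1 1 - r * ?T 0 0) + u * D
    = - ?q * ((a / (lam + r) - u) * ?T 0 0 - ?T 0 1 + (lam + 2 * r) * u / a * ?T 1 1)"
  proof -
    have c: "0 < ?q * u" using assms lam by simp
    have e: "?q * (a / (lam + r)) = r * a" using assms lam by simp
    \<comment> \<open>The analytic content of the identity: with \<open>T 0 1\<close> expanded, both
      sides are the same combination of \<open>T 0 0\<close>, \<open>T 1 1\<close> and
      \<open>T 2 2\<close>.\<close>
    have T01: "?T 0 1 = ?T 1 1 + ?q * u / (a * (a + 1)) * ?T 2 2"
      by (rule T_contiguous[OF assms(1) c])
    have "- ?q * ((a / (lam + r) - u) * ?T 0 0 - ?T 0 1 + (lam + 2 * r) * u / a * ?T 1 1)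
      = - (?q * (a / (lam + r))) * ?T 0 0 + ?q * u * ?T 0 0 + ?q * ?T 0 1 - ?q * ((lam + 2 * r) * u / a * ?T 1 1)"
    proof -
      have "- q * ((k - u) * A - B + C) = - (q * k) * A + q * u * A + q * B - q * C" for q k A B C :: real
        by (simp add: algebra_simps)
      then show ?thesis .
    qed
    also have "\<dots> = (a - lam * u) * (?q / a * ?T 1 1 - r * ?T 0 0) - u * r * (?q / a * ?T 1 1 - r * ?T 0 0) + u * D"
    proof -
      have alg: "- (r * a) * A + q * u * A + q * (B + q * u / (a * (a + 1)) * C) - q * ((lam + 2 * r) * u / a * B)
        = (a - lam * u) * (q / a * B - r * A) - u * r * (q / a * B - r * A) + u * (q / a * (q / (a + 1) * C) - r * (q / a * B))"
        if q: "q = r * (lam + r)" for q A B C :: real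
      proof -
        \<comment> \<open>\<open>q\<close> is expanded in the coefficient of \<open>u * A\<close>
          and stays an atom elsewhere, which keeps the polynomial identity small.\<close>
        have "- (r * a) * A + (r * (lam + r)) * u * A + q * (B + q * u / (a * (a + 1)) * C) - q * ((lam + 2 * r) * u / a * B)
          = (a - lam * u) * (q / a * B - r * A) - u * r * (q / a * B - r * A) + u * (q / a * (q / (a + 1) * C) - r * (q / a * B))"
          using a by (simp add: field_simps)
        then show ?thesis by (simp only: q)
      qed
      show ?thesis unfolding e D_def T01 by (rule alg[OF refl])
    qed
    finally show ?thesis ..
  qed
  ultimately show ?thesis
    by (simp add: h_r_def mult_ac)
qed

section \<open>Integrable majorants, locally uniform in \<open>r\<close>\<close>

definition envelope :: "real \<Rightarrow> real" where
  "envelope u = u powr (a - 1) * (1 + u) powr (- (a + 1))"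

lemma envelope_nonneg: "0 \<le> envelope u"
  by (simp add: envelope_def)

lemma set_integrable_envelope_bound:
  assumes "continuous_on {0<..} f" "\<And>u. 0 < u \<Longrightarrow> \<bar>f u\<bar> \<le> C * envelope u"
  shows "set_integrable lborel {0<..} f"
proof (rule set_integrable_bound)
  show "set_integrable lborel {0<..} (\<lambda>u. C * envelope u)"
    using set_integrable_powr_Ioi[of a] a by (auto simp: envelope_def[abs_def])
  show "set_borel_measurable lborel {0<..} f"
    unfolding set_borel_measurable_def using borel_measurable_continuous_on_indicator[OF _ assms(1)] by simp
  show "AE u in lborel. u \<in> {0<..} \<longrightarrow> norm (f u) \<le> norm (C * envelope u)"
    using assms(2) by (auto intro: order_trans[OF _ abs_ge_self])
qed

text \<open>The products of \<open>gamma_dens\<close> with \<open>h\<close>, \<open>h_u\<close> and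
  \<open>h_r\<close> are combinations of these functions, so one decay estimate serves all of
  them.\<close>

definition weight :: "nat \<Rightarrow> nat \<Rightarrow> real \<Rightarrow> real \<Rightarrow> real" where
  "weight i j r u = gamma_dens a lam u * (((lam + r) / lam) powr a * exp (- r * u)) * T i j r (r * (lam + r) * u)"

lemma weight_nonneg: "0 < r \<Longrightarrow> 0 < u \<Longrightarrow> 0 \<le> weight i j r u"
  unfolding weight_def using lam gamma_dens_pos[of u]
  by (intro mult_nonneg_nonneg T_nonneg) auto

lemma gamma_h_eq: "gamma_dens a lam u * h r u = weight 0 0 r u"
  and gamma_h_u_eq: "gamma_dens a lam u * h_u r u = r * (lam + r) / a * weight 1 1 r u - r * weight 0 0 r u"
  and gamma_h_r_eq: "gamma_dens a lam u * h_r r u =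
    (a / (lam + r) - u) * weight 0 0 r u - weight 0 1 r u + (lam + 2 * r) * u / a * weight 1 1 r u"
  by (simp_all add: weight_def h_def h_u_def h_r_def algebra_simps)

text \<open>The exponent of \<open>T_decay\<close> splits as
  \<open>a + 4 - j = (a + 1) + (3 - j)\<close>: the first part belongs to the envelope, and the
  \<open>3 - j\<close> spare powers of \<open>1 + u\<close> will absorb factors \<open>u\<close> and
  the logarithm.\<close>

lemma weight_bound:
  obtains C where "C > 0" and "\<And>i j r u. j \<le> 2 \<Longrightarrow> 0 < r \<Longrightarrow> r \<le> R \<Longrightarrow> 0 < u \<Longrightarrow>
    weight i j r u \<le> C * envelope u / (1 + u) ^ (3 - j)"
proof -
  have "\<forall>j::nat\<in>{..2}. \<exists>C>0. \<forall>i r u. 0 < r \<longrightarrow> r \<le> R \<longrightarrow> 0 < u \<longrightarrow>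
    exp (- (lam + r) * u) * T i j r (r * (lam + r) * u) \<le> C * (1 + u) powr (- (a + 4 - j))"
    using T_decay by simp
  from bchoice[OF this] obtain C where C0: "\<And>j. j \<le> 2 \<Longrightarrow> 0 < C j" and
    C: "\<And>i j r u. j \<le> 2 \<Longrightarrow> 0 < r \<Longrightarrow> r \<le> R \<Longrightarrow> 0 < u \<Longrightarrow>
      exp (- (lam + r) * u) * T i j r (r * (lam + r) * u) \<le> C j * (1 + u) powr (- (a + 4 - real j))"
    by (metis atMost_iff)
  \<comment> \<open>Summing over the three values of \<open>j\<close> gives one constant.\<close>
  define S where "S = (\<Sum>j\<le>2. C j)"
  have CS: "C j \<le> S" if "j \<le> 2" for j
    unfolding S_def using that C0 by (intro member_le_sum) (auto intro: less_imp_le)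
  have S: "S > 0" using CS[of 0] C0[of 0] by simp
  define K where "K = lam powr a / Gamma a * ((lam + \<bar>R\<bar>) / lam) powr a"
  have K: "K > 0" unfolding K_def using lam a by (simp add: Gamma_real_pos add_pos_nonneg)
  have "weight i j r u \<le> K * S * envelope u / (1 + u) ^ (3 - j)"
    if j: "j \<le> 2" and r: "0 < r" "r \<le> R" and u: "0 < u" for i j r u
  proof -
    let ?e = "exp (- (lam + r) * u) * T i j r (r * (lam + r) * u)"
    have e: "0 \<le> ?e" using r u lam by (intro mult_nonneg_nonneg T_nonneg) auto
    have "weight i j r u = (lam powr a / Gamma a * ((lam + r) / lam) powr a) * (u powr (a - 1) * ?e)"
      by (simp add: weight_def gamma_dens_def exp_add[symmetric] algebra_simps)
    also have "\<dots> \<le> K * (u powr (a - 1) * ?e)"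
      unfolding K_def using e r u lam a Gamma_real_pos[of a]
      by (intro mult_right_mono mult_left_mono powr_mono2 divide_right_mono) auto
    also have "\<dots> \<le> K * (u powr (a - 1) * (S * (1 + u) powr (- (a + 4 - real j))))"
      using K CS[OF j] by (intro mult_left_mono order_trans[OF C[OF j r u]] mult_right_mono) auto
    also have "(1 + u) powr (- (a + 4 - real j)) = (1 + u) powr (- (a + 1)) / (1 + u) ^ (3 - j)"
    proof -
      have eq: "- (a + 4 - real j) = - (a + 1) - real (3 - j)" using j by (simp add: of_nat_diff)
      show ?thesis
        unfolding eq powr_diff using u powr_realpow[of "1 + u" "3 - j"] by simp
    qed
    finally show ?thesis
      by (simp add: envelope_def mult_ac)
  qed
  then show ?thesis using that[of "K * S"] K S by auto
qed

text \<open>From below, \<open>T00_ge\<close> leaves \<open>exp (- R * u)\<close> times a positive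
  constant. From above, \<open>T_decay\<close> bounds \<open>exp (- (lam + r) * u) * T 0 0\<close>,
  so \<open>h\<close> grows at most like \<open>exp (lam * u)\<close>. The logarithm is therefore at
  most linear.\<close>

lemma ln_h_bound:
  assumes "0 < R"
  obtains C where "C > 0" and "\<And>r u. 0 < r \<Longrightarrow> r \<le> R \<Longrightarrow> 0 < u \<Longrightarrow> \<bar>ln (h r u)\<bar> \<le> C * (1 + u)"
proof -
  define c0 where "c0 = (LINT x|P. exp (- R * x))"
  have c0: "0 < c0" unfolding c0_def using exp_moment_pos assms .
  obtain C where C: "C > 0" and T: "\<And>i r u. 0 < r \<Longrightarrow> r \<le> R \<Longrightarrow> 0 < u \<Longrightarrow>
      exp (- (lam + r) * u) * T i 0 r (r * (lam + r) * u) \<le> C * (1 + u) powr (- (a + 4 - real 0))"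
    using T_decay[of 0 R] by auto
  define A where "A = ((lam + R) / lam) powr a"
  have A: "0 < A" unfolding A_def using lam assms by auto
  define K where "K = \<bar>ln c0\<bar> + \<bar>ln (A * C)\<bar> + R + lam"
  have K: "0 < K" unfolding K_def using assms lam by simp
  have "\<bar>ln (h r u)\<bar> \<le> K * (1 + u)" if r: "0 < r" "r \<le> R" and u: "0 < u" for r u
  proof -
    have c: "0 \<le> r * (lam + r) * u" using r u lam by simp
    have "1 * exp (- R * u) * c0 \<le> h r u"
      unfolding h_def using r u lam a c c0 T00_ge[OF r c]
      by (intro mult_mono ge_one_powr_ge_zero) (auto simp: c0_def)
    then have "ln (exp (- R * u) * c0) \<le> ln (h r u)"
      using c0 h_pos[OF r(1) u] by simp
    then have lower: "ln c0 - R * u \<le> ln (h r u)"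
      using c0 by (simp add: ln_mult)
    have "exp (- (lam + r) * u) * T 0 0 r (r * (lam + r) * u) \<le> C * 1"
    proof (rule order_trans[OF T[OF r u]])
      show "C * (1 + u) powr (- (a + 4 - real 0)) \<le> C * 1"
        using C u a powr_mono[of "- (a + 4)" 0 "1 + u"] by (intro mult_left_mono) auto
    qed
    note bound = this
    have "((lam + r) / lam) powr a * (exp (- (lam + r) * u) * T 0 0 r (r * (lam + r) * u)) \<le> A * (C * 1)"
    proof (rule mult_mono)
      show "((lam + r) / lam) powr a \<le> A"
        unfolding A_def using r lam a by (intro powr_mono2 divide_right_mono) auto
    qed (use A bound T_nonneg[OF r(1) c, of 0 0] in auto)
    then have "exp (lam * u) * (((lam + r) / lam) powr a * (exp (- (lam + r) * u) * T 0 0 r (r * (lam + r) * u))) \<le> exp (lam * u) * (A * C)"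
      by simp
    moreover have "exp (- r * u) = exp (lam * u) * exp (- (lam + r) * u)"
      by (simp add: exp_add[symmetric] algebra_simps)
    ultimately have "h r u \<le> exp (lam * u) * (A * C)"
      by (simp add: h_def mult_ac)
    then have "ln (h r u) \<le> ln (exp (lam * u) * (A * C))"
      using h_pos[OF r(1) u] by simp
    also have "\<dots> = lam * u + ln (A * C)"
      using A C by (simp add: ln_mult)
    finally have upper: "ln (h r u) \<le> lam * u + ln (A * C)" .
    have "\<bar>ln (h r u)\<bar> \<le> \<bar>ln c0\<bar> + \<bar>ln (A * C)\<bar> + (R + lam) * u"
    proof -
      have "0 \<le> R * u" "0 \<le> lam * u" using assms lam u by simp_all
      then show ?thesis using lower upper by (simp add: distrib_right abs_le_iff; linarith)
    qed
    also have "\<dots> \<le> K * (1 + u)"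
      using u assms lam by (simp add: K_def algebra_simps)
    finally show ?thesis .
  qed
  then show ?thesis using that K by blast
qed

text \<open>The logarithm and each factor \<open>u\<close> cost one spare power from
  \<open>weight_bound\<close>. The third majorant retains the factor \<open>u / (1 + u)\<close>,
  which makes the boundary terms vanish; the fourth estimate, with \<open>h\<close> in the
  denominator, rests on Cauchy--Schwarz.\<close>

lemma gamma_h_bounds:
  assumes "0 < R"
  obtains C where "C > 0"
    and "\<And>r u. 0 < r \<Longrightarrow> r \<le> R \<Longrightarrow> 0 < u \<Longrightarrow> \<bar>gamma_dens a lam u * h r u * ln (h r u)\<bar> \<le> C * envelope u"
    and "\<And>r u. 0 < r \<Longrightarrow> r \<le> R \<Longrightarrow> 0 < u \<Longrightarrow> \<bar>gamma_dens a lam u * h_r r u * (ln (h r u) + 1)\<bar> \<le> C * envelope u"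
    and "\<And>r u. 0 < r \<Longrightarrow> r \<le> R \<Longrightarrow> 0 < u \<Longrightarrow> \<bar>gamma_dens a lam u * u * h_u r u * (ln (h r u) + 1)\<bar> \<le> C * (u * envelope u / (1 + u))"
    and "\<And>r u. 0 < r \<Longrightarrow> r \<le> R \<Longrightarrow> 0 < u \<Longrightarrow> \<bar>gamma_dens a lam u * u * (h_u r u)\<^sup>2 / h r u\<bar> \<le> C * envelope u"
proof -
  obtain W where W: "W > 0" and wb: "\<And>i j r u. j \<le> 2 \<Longrightarrow> 0 < r \<Longrightarrow> r \<le> R \<Longrightarrow> 0 < u \<Longrightarrow>
    weight i j r u \<le> W * envelope u / (1 + u) ^ (3 - j)" using weight_bound[of R] by blast
  obtain L where L: "L > 0" and lb: "\<And>r u. 0 < r \<Longrightarrow> r \<le> R \<Longrightarrow> 0 < u \<Longrightarrow> \<bar>ln (h r u)\<bar> \<le> L * (1 + u)"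
    using ln_h_bound[OF assms] by blast
  define Q where "Q = R * (lam + R)"
  define C1 where "C1 = W * L"
  define C2 where "C2 = ((a / lam + 1) + 1 + (lam + 2 * R) / a) * W * (L + 1)"
  define C3 where "C3 = (Q / a + R) * W * (L + 1)"
  define C4 where "C4 = 2 * ((Q / a)\<^sup>2 + R\<^sup>2) * W"
  have Q: "Q > 0" unfolding Q_def using assms lam by simp
  have a0: "a > 0" using a by simp
  have Cpos: "C1 > 0" "C2 > 0" "C3 > 0" "C4 > 0"
    unfolding C1_def C2_def C3_def C4_def using W L Q lam a0 assms
    by (auto intro!: mult_pos_pos add_pos_pos)
  have "\<bar>gamma_dens a lam u * h r u * ln (h r u)\<bar> \<le> C1 * envelope u
    \<and> \<bar>gamma_dens a lam u * h_r r u * (ln (h r u) + 1)\<bar> \<le> C2 * envelope u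
    \<and> \<bar>gamma_dens a lam u * u * h_u r u * (ln (h r u) + 1)\<bar> \<le> C3 * (u * envelope u / (1 + u))
    \<and> \<bar>gamma_dens a lam u * u * (h_u r u)\<^sup>2 / h r u\<bar> \<le> C4 * envelope u"
    if r: "0 < r" "r \<le> R" and u: "0 < u" for r u
  proof -
    define v where "v = 1 + u"
    have v: "1 \<le> v" "0 < v" "u \<le> v" using u by (auto simp: v_def)
    define N where "N = W * envelope u"
    have N: "0 \<le> N" unfolding N_def using W envelope_nonneg by simp
    have w3: "weight i 0 r u \<le> N / v ^ 3" and w2: "weight i 1 r u \<le> N / v\<^sup>2" and w1: "weight i 2 r u \<le> N / v" for i
      using wb[of 0 r u i] wb[of 1 r u i] wb[of 2 r u i] r u by (simp_all add: N_def v_def)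
    have w0: "0 \<le> weight i j r u" for i j by (rule weight_nonneg[OF r(1) u])
    have "N / v ^ 3 \<le> N / v\<^sup>2" using v N by (intro divide_left_mono power_increasing) auto
    then have w32: "weight i 0 r u \<le> N / v\<^sup>2" for i using w3[of i] by simp
    have "N / v\<^sup>2 \<le> N / v" using v N by (intro divide_left_mono self_le_power) auto
    then have w31: "weight i 0 r u \<le> N / v" for i using w32[of i] by simp
    have w21: "weight i 1 r u \<le> N / v" for i using w2[of i] \<open>N / v\<^sup>2 \<le> N / v\<close> by simp
    \<comment> \<open>A factor \<open>u \<le> v\<close> is paid for with one power of
      \<open>v\<close>.\<close>
    have uw: "u * weight i j r u \<le> N / v" if "weight i j r u \<le> N / v\<^sup>2" for i j
    proof -
      have "u * weight i j r u \<le> v * (N / v\<^sup>2)" using that w0 v u N by (intro mult_mono) auto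
      then show ?thesis using v by (simp add: power2_eq_square)
    qed
    have l: "\<bar>ln (h r u)\<bar> \<le> L * v" using lb[OF r u] by (simp add: v_def)
    have l1: "\<bar>ln (h r u) + 1\<bar> \<le> (L + 1) * v"
      using l v by (simp add: distrib_right)
    have q: "r * (lam + r) \<le> Q" unfolding Q_def using r lam by (intro mult_mono) auto
    have q0: "0 < r * (lam + r)" using r lam by simp
    have hp: "0 < h r u" by (rule h_pos[OF r(1) u])
    have "\<bar>gamma_dens a lam u * h r u * ln (h r u)\<bar> \<le> N / v * (L * v)"
      using w31[of 0] w0[of 0 0] l unfolding gamma_h_eq abs_mult by (intro mult_mono) auto
    then have 1: "\<bar>gamma_dens a lam u * h r u * ln (h r u)\<bar> \<le> C1 * envelope u"
      using v by (simp add: C1_def N_def mult_ac)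
    have "\<bar>gamma_dens a lam u * h_r r u\<bar> \<le> \<bar>a / (lam + r) * weight 0 0 r u\<bar> + \<bar>u * weight 0 0 r u\<bar> + \<bar>weight 0 1 r u\<bar>
        + \<bar>(lam + 2 * r) / a * (u * weight 1 1 r u)\<bar>"
    proof -
      have "\<bar>(k - u) * x - y + l * u / a * z\<bar> \<le> \<bar>k * x\<bar> + \<bar>u * x\<bar> + \<bar>y\<bar> + \<bar>l / a * (u * z)\<bar>" for k l x y z :: real
      proof -
        have "(k - u) * x - y + l * u / a * z = k * x - u * x - y + l / a * (u * z)"
          by (simp add: left_diff_distrib)
        then show ?thesis by linarith
      qed
      then show ?thesis unfolding gamma_h_r_eq .
    qed
    also have "\<dots> \<le> a / lam * (N / v) + N / v + N / v + (lam + 2 * R) / a * (N / v)"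
    proof (intro add_mono)
      show "\<bar>a / (lam + r) * weight 0 0 r u\<bar> \<le> a / lam * (N / v)"
        unfolding abs_mult using w0[of 0 0] w31[of 0] a0 lam r
        by (intro mult_mono) (auto intro!: divide_left_mono)
      show "\<bar>u * weight 0 0 r u\<bar> \<le> N / v"
        using uw[OF w32[of 0]] w0[of 0 0] u by simp
      show "\<bar>weight 0 1 r u\<bar> \<le> N / v"
        using w21[of 0] w0[of 0 1] by simp
      show "\<bar>(lam + 2 * r) / a * (u * weight 1 1 r u)\<bar> \<le> (lam + 2 * R) / a * (N / v)"
        unfolding abs_mult[of "(lam + 2 * r) / a"] using uw[OF w2[of 1]] w0[of 1 1] u a0 lam r N v
        by (intro mult_mono) (auto intro!: divide_right_mono)
    qed
    also have "\<dots> = ((a / lam + 1) + 1 + (lam + 2 * R) / a) * (N / v)"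
      by (simp add: algebra_simps)
    finally have "\<bar>gamma_dens a lam u * h_r r u * (ln (h r u) + 1)\<bar> \<le> ((a / lam + 1) + 1 + (lam + 2 * R) / a) * (N / v) * ((L + 1) * v)"
      using l1 unfolding abs_mult[of _ "ln (h r u) + 1"] by (rule mult_mono) (use N v lam a0 assms in auto)
    then have 2: "\<bar>gamma_dens a lam u * h_r r u * (ln (h r u) + 1)\<bar> \<le> C2 * envelope u"
      using v by (simp add: C2_def N_def mult_ac)
    have "\<bar>gamma_dens a lam u * h_u r u\<bar> \<le> \<bar>r * (lam + r) / a * weight 1 1 r u\<bar> + \<bar>r * weight 0 0 r u\<bar>"
      unfolding gamma_h_u_eq by (rule abs_triangle_ineq4)
    also have "\<dots> \<le> Q / a * (N / v\<^sup>2) + R * (N / v\<^sup>2)"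
    proof (intro add_mono)
      show "\<bar>r * (lam + r) / a * weight 1 1 r u\<bar> \<le> Q / a * (N / v\<^sup>2)"
        using w0 q q0 a0 w2[of 1] N Q unfolding abs_mult by (intro mult_mono) (auto intro!: divide_right_mono)
      show "\<bar>r * weight 0 0 r u\<bar> \<le> R * (N / v\<^sup>2)"
        using w0 r w32[of 0] N unfolding abs_mult by (intro mult_mono) auto
    qed
    finally have "\<bar>gamma_dens a lam u * h_u r u\<bar> \<le> (Q / a + R) * (N / v\<^sup>2)"
      by (simp only: distrib_right)
    then have "\<bar>gamma_dens a lam u * h_u r u\<bar> * \<bar>ln (h r u) + 1\<bar> \<le> (Q / a + R) * (N / v\<^sup>2) * ((L + 1) * v)"
      by (rule mult_mono[OF _ l1]) (use N Q a0 assms in auto)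
    then have "u * (\<bar>gamma_dens a lam u * h_u r u\<bar> * \<bar>ln (h r u) + 1\<bar>) \<le> u * ((Q / a + R) * (N / v\<^sup>2) * ((L + 1) * v))"
      using u by (intro mult_left_mono) auto
    moreover have "u * (\<bar>gamma_dens a lam u * h_u r u\<bar> * \<bar>ln (h r u) + 1\<bar>) = \<bar>gamma_dens a lam u * u * h_u r u * (ln (h r u) + 1)\<bar>"
      using u by (simp add: abs_mult)
    moreover have "u * ((Q / a + R) * (N / v\<^sup>2) * ((L + 1) * v)) = C3 * (u * envelope u / v)"
      using v by (simp add: C3_def N_def power2_eq_square)
    ultimately have 3: "\<bar>gamma_dens a lam u * u * h_u r u * (ln (h r u) + 1)\<bar> \<le> C3 * (u * envelope u / v)"
      by simp
    have 4: "\<bar>gamma_dens a lam u * u * (h_u r u)\<^sup>2 / h r u\<bar> \<le> C4 * envelope u"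
    proof -
      let ?c = "r * (lam + r) * u" and ?q = "r * (lam + r)"
      let ?E = "((lam + r) / lam) powr a * exp (- r * u)"
      have c: "0 < ?c" using q0 u by simp
      have E: "?E > 0" using r lam by simp
      have g: "gamma_dens a lam u > 0" using u by (rule gamma_dens_pos)
      have T0: "0 < T 0 0 r ?c" using T00_pos r c by simp
      \<comment> \<open>The aim is a bound on the square with the factor \<open>T 0 0\<close>, which
        cancels the \<open>T 0 0\<close> inside \<open>h\<close>; what remains is linear in
        \<open>T 0 2\<close> and \<open>T 0 0\<close>.\<close>
      have "(T 1 1 r ?c)\<^sup>2 \<le> (T 0 1 r ?c)\<^sup>2"
        using T_antimono_param[of r ?c 0 1] T_nonneg[of r ?c 1 1] r c by (intro power_mono) auto
      also have "\<dots> \<le> T 0 0 r ?c * T 0 2 r ?c"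
        using T_Cauchy_Schwarz[of r ?c] r c by simp
      finally have T11: "(T 1 1 r ?c)\<^sup>2 \<le> T 0 0 r ?c * T 0 2 r ?c" .
      have "(?q / a * T 1 1 r ?c - r * T 0 0 r ?c)\<^sup>2 \<le> 2 * ((?q / a)\<^sup>2 * (T 1 1 r ?c)\<^sup>2 + r\<^sup>2 * (T 0 0 r ?c)\<^sup>2)"
      proof -
        have "(k * x - l * y)\<^sup>2 \<le> 2 * (k\<^sup>2 * x\<^sup>2 + l\<^sup>2 * y\<^sup>2)" for k l x y :: real
          using zero_le_power2[of "k * x + l * y"] by (simp add: power2_eq_square algebra_simps)
        then show ?thesis .
      qed
      also have "\<dots> \<le> 2 * ((?q / a)\<^sup>2 * (T 0 0 r ?c * T 0 2 r ?c) + r\<^sup>2 * (T 0 0 r ?c)\<^sup>2)"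
        using T11 by (simp add: mult_left_mono)
      also have "\<dots> = T 0 0 r ?c * (2 * ((?q / a)\<^sup>2 * T 0 2 r ?c + r\<^sup>2 * T 0 0 r ?c))"
        by (simp add: algebra_simps power2_eq_square)
      finally have "?E * (?q / a * T 1 1 r ?c - r * T 0 0 r ?c)\<^sup>2 / T 0 0 r ?c \<le> ?E * (2 * ((?q / a)\<^sup>2 * T 0 2 r ?c + r\<^sup>2 * T 0 0 r ?c))"
      proof -
        have "e * s / t \<le> e * w" if "s \<le> t * w" "0 < t" "0 < e" for e s t w :: real
          using that by (simp add: divide_le_eq mult_ac)
        from this[OF _ T0 E] show "(?q / a * T 1 1 r ?c - r * T 0 0 r ?c)\<^sup>2
            \<le> T 0 0 r ?c * (2 * ((?q / a)\<^sup>2 * T 0 2 r ?c + r\<^sup>2 * T 0 0 r ?c)) \<Longrightarrow> ?thesis" .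
      qed
      moreover have "(h_u r u)\<^sup>2 / h r u = ?E * (?q / a * T 1 1 r ?c - r * T 0 0 r ?c)\<^sup>2 / T 0 0 r ?c"
      proof -
        have "(e * x)\<^sup>2 / (e * y) = e * x\<^sup>2 / y" if "0 < e" for e x y :: real
          using that by (simp add: power2_eq_square)
        from this[OF E] show ?thesis unfolding h_u_def h_def .
      qed
      ultimately have "(h_u r u)\<^sup>2 / h r u \<le> ?E * (2 * ((?q / a)\<^sup>2 * T 0 2 r ?c + r\<^sup>2 * T 0 0 r ?c))" by simp
      then have "gamma_dens a lam u * u * ((h_u r u)\<^sup>2 / h r u) \<le> gamma_dens a lam u * u * (?E * (2 * ((?q / a)\<^sup>2 * T 0 2 r ?c + r\<^sup>2 * T 0 0 r ?c)))"
        using g u by (intro mult_left_mono) auto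
      also have "\<dots> = u * (2 * ((?q / a)\<^sup>2 * weight 0 2 r u + r\<^sup>2 * weight 0 0 r u))"
      proof -
        have "g * u * (e * (2 * (k * x + l * y))) = u * (2 * (k * (g * e * x) + l * (g * e * y)))" for g e k l x y :: real
          by (simp add: algebra_simps)
        then show ?thesis unfolding weight_def .
      qed
      also have "\<dots> \<le> v * (2 * ((Q / a)\<^sup>2 * (N / v) + R\<^sup>2 * (N / v)))"
        using v u w0 w1[of 0] w31[of 0] q q0 a0 r N
        by (intro mult_mono mult_left_mono add_mono power_mono divide_right_mono) auto
      also have "\<dots> = C4 * envelope u"
        using v by (simp add: C4_def N_def field_simps)
      finally show ?thesis
        using g u hp by simp
    qed
    show ?thesis using 1 2 3 4 unfolding v_def by blast
  qed
  note bounds = this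
  show ?thesis
  proof (rule that[of "C1 + C2 + C3 + C4"])
    have enlarge: "x \<le> (C1 + C2 + C3 + C4) * y" if "x \<le> C * y" "0 \<le> y" "C \<in> {C1, C2, C3, C4}" for x y C
    proof (rule order_trans[OF that(1)])
      show "C * y \<le> (C1 + C2 + C3 + C4) * y"
        using that Cpos by (intro mult_right_mono) auto
    qed
    fix r u :: real
    assume r: "0 < r" "r \<le> R" and u: "0 < u"
    have y: "0 \<le> u * envelope u / (1 + u)" using u envelope_nonneg[of u] by simp
    note b = bounds[OF r u] and e = envelope_nonneg[of u]
    show "\<bar>gamma_dens a lam u * h r u * ln (h r u)\<bar> \<le> (C1 + C2 + C3 + C4) * envelope u"
      by (rule enlarge[of _ C1]) (use b e in auto)
    show "\<bar>gamma_dens a lam u * h_r r u * (ln (h r u) + 1)\<bar> \<le> (C1 + C2 + C3 + C4) * envelope u"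
      by (rule enlarge[of _ C2]) (use b e in auto)
    show "\<bar>gamma_dens a lam u * u * h_u r u * (ln (h r u) + 1)\<bar> \<le> (C1 + C2 + C3 + C4) * (u * envelope u / (1 + u))"
      by (rule enlarge[of _ C3]) (use b y in auto)
    show "\<bar>gamma_dens a lam u * u * (h_u r u)\<^sup>2 / h r u\<bar> \<le> (C1 + C2 + C3 + C4) * envelope u"
      by (rule enlarge[of _ C4]) (use b e in auto)
  qed (use Cpos in simp)
qed

subsection \<open>Entropy production along the smart path\<close>

lemma continuous_on_gamma_dens: "continuous_on {0<..} (gamma_dens a lam)"
  by (intro continuous_at_imp_continuous_on ballI DERIV_isCont[OF has_real_derivative_gamma_dens]) auto

lemma continuous_on_h: "0 < r \<Longrightarrow> continuous_on {0<..} (h r)"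
  by (intro continuous_at_imp_continuous_on ballI DERIV_isCont[OF has_real_derivative_h]) auto

lemma continuous_on_h_u: "0 < r \<Longrightarrow> continuous_on {0<..} (h_u r)"
  and continuous_on_h_r: "0 < r \<Longrightarrow> continuous_on {0<..} (h_r r)"
  unfolding h_u_def[abs_def] h_r_def[abs_def] using lam a by (auto intro!: continuous_intros)

lemma entropy_integrands:
  assumes "0 < r"
  shows continuous_on_h_r_ln: "continuous_on {0<..} (\<lambda>u. gamma_dens a lam u * h_r r u * (ln (h r u) + 1))"
    and continuous_on_fisher: "continuous_on {0<..} (\<lambda>u. gamma_dens a lam u * u * (h_u r u)\<^sup>2 / h r u)"
    and integrable_h_ln: "set_integrable lborel {0<..} (\<lambda>u. gamma_dens a lam u * h r u * ln (h r u))"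
    and integrable_h_r_ln: "set_integrable lborel {0<..} (\<lambda>u. gamma_dens a lam u * h_r r u * (ln (h r u) + 1))"
    and integrable_fisher: "set_integrable lborel {0<..} (\<lambda>u. gamma_dens a lam u * u * (h_u r u)\<^sup>2 / h r u)"
proof -
  have hp: "h r u \<noteq> 0" if "u \<in> {0<..}" for u using h_pos[OF assms, of u] that by simp
  note c = continuous_on_gamma_dens continuous_on_h[OF assms] continuous_on_h_u[OF assms] continuous_on_h_r[OF assms]
  show 1: "continuous_on {0<..} (\<lambda>u. gamma_dens a lam u * h_r r u * (ln (h r u) + 1))"
    and 2: "continuous_on {0<..} (\<lambda>u. gamma_dens a lam u * u * (h_u r u)\<^sup>2 / h r u)"
    using hp by (auto intro!: continuous_intros c)
  have 3: "continuous_on {0<..} (\<lambda>u. gamma_dens a lam u * h r u * ln (h r u))"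
    using hp by (auto intro!: continuous_intros c)
  obtain C where "C > 0"
    and b1: "\<And>u. 0 < u \<Longrightarrow> \<bar>gamma_dens a lam u * h r u * ln (h r u)\<bar> \<le> C * envelope u"
    and b2: "\<And>u. 0 < u \<Longrightarrow> \<bar>gamma_dens a lam u * h_r r u * (ln (h r u) + 1)\<bar> \<le> C * envelope u"
    and b3: "\<And>u. 0 < u \<Longrightarrow> \<bar>gamma_dens a lam u * u * (h_u r u)\<^sup>2 / h r u\<bar> \<le> C * envelope u"
    using gamma_h_bounds[OF assms] assms by (metis order.refl)
  show "set_integrable lborel {0<..} (\<lambda>u. gamma_dens a lam u * h r u * ln (h r u))"
    by (rule set_integrable_envelope_bound[OF 3 b1])
  show "set_integrable lborel {0<..} (\<lambda>u. gamma_dens a lam u * h_r r u * (ln (h r u) + 1))"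
    by (rule set_integrable_envelope_bound[OF 1 b2])
  show "set_integrable lborel {0<..} (\<lambda>u. gamma_dens a lam u * u * (h_u r u)\<^sup>2 / h r u)"
    by (rule set_integrable_envelope_bound[OF 2 b3])
qed

text \<open>The third majorant equals \<open>(u / (1 + u)) powr a / (1 + u)\<^sup>2\<close> up to a
  constant: at most \<open>u powr a\<close> near 0 and at most \<open>1 / (1 + u)\<^sup>2\<close> at
  infinity.\<close>

lemma flux_vanishes:
  assumes "0 < r"
  shows "((\<lambda>u. gamma_dens a lam u * u * h_u r u * (ln (h r u) + 1)) \<longlongrightarrow> 0) (at_right 0)" (is "(?G \<longlongrightarrow> 0) _")
    and "((\<lambda>u. gamma_dens a lam u * u * h_u r u * (ln (h r u) + 1)) \<longlongrightarrow> 0) at_top"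
proof -
  obtain C where C: "C > 0" and G: "\<And>u. 0 < u \<Longrightarrow> \<bar>?G u\<bar> \<le> C * (u * envelope u / (1 + u))"
    using gamma_h_bounds[OF assms] assms by (metis order.refl)
  have e: "u * envelope u / (1 + u) = (u / (1 + u)) powr a / (1 + u)\<^sup>2" if "0 < u" for u
  proof -
    have "u * u powr (a - 1) = u powr a" using that by (simp add: powr_diff)
    moreover have "(1 + u) powr (- (a + 1)) = 1 / ((1 + u) powr a * (1 + u))"
      unfolding powr_minus_divide powr_add using that by simp
    ultimately show ?thesis
      using that by (simp add: envelope_def powr_divide power2_eq_square flip: mult.assoc)
  qed
  have "\<bar>?G u\<bar> \<le> C * u powr a" if "0 < u" for u
  proof -
    have "(u / (1 + u)) powr a / (1 + u)\<^sup>2 \<le> u powr a / 1"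
      using that a by (intro frac_le powr_mono2) (auto simp: divide_le_eq algebra_simps)
    then show ?thesis using G[OF that] C e[OF that] by (smt (verit) div_by_1 mult_left_mono)
  qed
  moreover have "((\<lambda>u. C * u powr a) \<longlongrightarrow> C * 0 powr a) (at_right 0)"
    using a by (intro tendsto_intros) (auto simp: eventually_at_filter)
  ultimately show "(?G \<longlongrightarrow> 0) (at_right 0)"
    using a by (intro Lim_null_comparison[of ?G "\<lambda>u. C * u powr a"]) (auto simp: eventually_at_filter)
  have "\<bar>?G u\<bar> \<le> C * (1 / (1 + u)\<^sup>2)" if "0 < u" for u
  proof -
    have "(u / (1 + u)) powr a \<le> 1"
      using that a by (intro powr_le1) auto
    then have "(u / (1 + u)) powr a / (1 + u)\<^sup>2 \<le> 1 / (1 + u)\<^sup>2"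
      by (intro divide_right_mono) auto
    then show ?thesis using G[OF that] C e[OF that] by (smt (verit) mult_left_mono)
  qed
  moreover have "((\<lambda>u. C * (1 / (1 + u)\<^sup>2)) \<longlongrightarrow> C * 0) at_top"
    by (intro tendsto_mult tendsto_const) real_asymp
  ultimately show "(?G \<longlongrightarrow> 0) at_top"
    by (intro Lim_null_comparison[of ?G "\<lambda>u. C * (1 / (1 + u)\<^sup>2)"])
      (auto intro: eventually_mono[OF eventually_gt_at_top[of 0]])
qed

text \<open>Integration by parts: by the heat equation, the flux times \<open>ln h + 1\<close> has
  as derivative the Fisher integrand minus \<open>r * (lam + r)\<close> times the entropy integrand,
  and its boundary values are 0.\<close>

lemma entropy_production:
  assumes "0 < r"
  shows "(LBINT u:{0<..}. gamma_dens a lam u * h_r r u * (ln (h r u) + 1))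
    = 1 / (r * (lam + r)) * (LBINT u:{0<..}. gamma_dens a lam u * u * (h_u r u)\<^sup>2 / h r u)"
proof -
  let ?q = "r * (lam + r)"
  let ?t = "\<lambda>u. gamma_dens a lam u * h_r r u * (ln (h r u) + 1)"
  let ?s = "\<lambda>u. gamma_dens a lam u * u * (h_u r u)\<^sup>2 / h r u"
  have q: "?q > 0" using assms lam by simp
  note I = integrable_h_r_ln[OF assms] integrable_fisher[OF assms]
  have "(LBINT u:{0<..}. ?s u - ?q * ?t u) = 0 - 0"
  proof (rule integral_FTC_Ioi[OF _ _ _ flux_vanishes[OF assms]])
    fix u :: real assume u: "0 < u"
    have "((\<lambda>u. ln (h r u) + 1) has_real_derivative h_u r u / h r u) (at u)"
      using h_pos[OF assms u] by (auto intro!: derivative_eq_intros has_real_derivative_h assms u)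
    from DERIV_mult[OF has_real_derivative_flux[OF assms u] this]
    show "((\<lambda>u. gamma_dens a lam u * u * h_u r u * (ln (h r u) + 1)) has_real_derivative ?s u - ?q * ?t u) (at u)"
      by (rule DERIV_cong) (simp add: power2_eq_square)
    have "continuous_on {0<..} (\<lambda>u. ?s u - ?q * ?t u)"
      by (intro continuous_on_diff continuous_on_mult continuous_on_const continuous_on_h_r_ln continuous_on_fisher assms)
    then show "isCont (\<lambda>u. ?s u - ?q * ?t u) u"
      using u by (simp add: continuous_on_eq_continuous_at)
  next
    show "set_integrable lborel {0<..} (\<lambda>u. ?s u - ?q * ?t u)"
      by (intro set_integral_diff(1) set_integrable_mult_right I)
  qed
  moreover have "(LBINT u:{0<..}. ?s u - ?q * ?t u) = (LBINT u:{0<..}. ?s u) - ?q * (LBINT u:{0<..}. ?t u)"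
    using I by (subst set_integral_diff(2)) (auto intro: set_integrable_mult_right)
  ultimately show ?thesis
    using q by (simp add: field_simps)
qed

lemma has_real_derivative_entropy:
  assumes "0 < r"
  shows "((\<lambda>r. LBINT u:{0<..}. gamma_dens a lam u * h r u * ln (h r u)) has_real_derivative
    1 / (r * (lam + r)) * (LBINT u:{0<..}. gamma_dens a lam u * u * (h_u r u)\<^sup>2 / h r u)) (at r)"
proof -
  let ?I = "\<lambda>u. indicat_real {0<..} u"
  let ?f = "\<lambda>r u. ?I u *\<^sub>R (gamma_dens a lam u * h r u * ln (h r u))"
  let ?f' = "\<lambda>r u. ?I u *\<^sub>R (gamma_dens a lam u * h_r r u * (ln (h r u) + 1))"
  obtain C where C: "C > 0" and
    bd: "\<And>s u. 0 < s \<Longrightarrow> s \<le> 2 * r \<Longrightarrow> 0 < u \<Longrightarrow> \<bar>gamma_dens a lam u * h_r s u * (ln (h s u) + 1)\<bar> \<le> C * envelope u"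
    using gamma_h_bounds[of "2 * r"] assms by (metis mult_pos_pos zero_less_numeral)
  have "((\<lambda>r. integral\<^sup>L lborel (?f r)) has_real_derivative integral\<^sup>L lborel (?f' r)) (at r)"
  \<comment> \<open>The majorant holds uniformly for \<open>0 < s \<le> 2 * r\<close>, so the
    interval may reach down to 0.\<close>
  proof (rule has_real_derivative_integral(1)[where l = 0 and R = "2 * r" and B = "\<lambda>u. ?I u *\<^sub>R (C * envelope u)"])
    show "integrable lborel (?f s)" if "s \<in> {0<..<2 * r}" for s
      using integrable_h_ln[of s] that by (simp add: set_integrable_def)
    show "?f' r \<in> borel_measurable lborel"
      using integrable_h_r_ln[OF assms] unfolding set_integrable_def by (rule borel_measurable_integrable)
    show "integrable lborel (\<lambda>u. ?I u *\<^sub>R (C * envelope u))"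
      using set_integrable_mult_right[of C lborel "{0<..}" envelope] set_integrable_powr_Ioi[of a] a
      by (simp add: set_integrable_def envelope_def[abs_def])
    have "((\<lambda>r. ?f r u) has_real_derivative ?f' s u) (at s) \<and> \<bar>?f' s u\<bar> \<le> ?I u *\<^sub>R (C * envelope u)"
      if s: "s \<in> {0<..<2 * r}" for s u
    proof (cases "0 < u")
      case True
      have "((\<lambda>r. gamma_dens a lam u * h r u) has_real_derivative gamma_dens a lam u * h_r s u) (at s)"
        using s True by (intro DERIV_cmult has_real_derivative_h_path) auto
      moreover have "((\<lambda>r. ln (h r u)) has_real_derivative h_r s u / h s u) (at s)"
        using h_pos[of s u] s True by (auto intro!: derivative_eq_intros has_real_derivative_h_path)
      ultimately have "((\<lambda>r. gamma_dens a lam u * h r u * ln (h r u)) has_real_derivative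
          gamma_dens a lam u * h_r s u * ln (h s u) + h_r s u / h s u * (gamma_dens a lam u * h s u)) (at s)"
        by (rule DERIV_mult)
      then have "((\<lambda>r. gamma_dens a lam u * h r u * ln (h r u)) has_real_derivative
          gamma_dens a lam u * h_r s u * (ln (h s u) + 1)) (at s)"
        using h_pos[of s u] s True by (elim DERIV_cong) (simp add: algebra_simps)
      then show ?thesis using True bd[of s u] s by simp
    qed simp
    then show "AE u in lborel. \<forall>s\<in>{0<..<2 * r}. ((\<lambda>r. ?f r u) has_real_derivative ?f' s u) (at s)
        \<and> \<bar>?f' s u\<bar> \<le> ?I u *\<^sub>R (C * envelope u)"
      by blast
  qed (use assms in auto)
  then show ?thesis
    unfolding entropy_production[OF assms, unfolded set_lebesgue_integral_def] set_lebesgue_integral_def .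
qed

section \<open>Return to the time parameter of the smart path\<close>

text \<open>Since \<open>lam + r = lam / (1 - t)\<close>, half the Bessel argument has square
  \<open>r * (lam + r) * u * x\<close>. The power of \<open>x\<close> from
  \<open>bessel_I_eq_hyp01\<close> cancels the one in the mixture, and \<open>?K\<close> collects
  the factors free of \<open>x\<close>.\<close>

lemma smart_path_dens_eq:
  assumes t: "0 < t" "t < 1" and u: "0 < u"
  shows "smart_path_dens a lam P t u = gamma_dens a lam u * h (lam * t / (1 - t)) u"
proof -
  let ?r = "lam * t / (1 - t)"
  have r: "?r > 0" using t lam by simp
  have b: "lam + ?r = lam / (1 - t)" using t by (simp add: field_simps)
  let ?b = "lam / (1 - t)" and ?c = "?r * (lam + ?r) * u"
  have bpos: "?b > 0" using t lam by simp
  let ?K = "?b powr (a - 1) * (u * t) powr ((a - 1) / 2) / Gamma a"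
  have "(LINT x|P. x powr (- (a - 1) / 2) * exp (- lam * t * x / (1 - t)) *
        bessel_I (a - 1) (2 * lam * sqrt (u * x * t) / (1 - t)))
      = (LINT x|P. ?K * (x ^ 0 * exp (- ?r * x) * hyp01 (a + real 0) (?c * x)))"
  proof (rule integral_cong_AE)
    show "(\<lambda>x. x powr (- (a - 1) / 2) * exp (- lam * t * x / (1 - t)) *
        bessel_I (a - 1) (2 * lam * sqrt (u * x * t) / (1 - t))) \<in> borel_measurable P"
      unfolding bessel_I_def by measurable
    show "(\<lambda>x. ?K * (x ^ 0 * exp (- ?r * x) * hyp01 (a + real 0) (?c * x))) \<in> borel_measurable P"
      by (intro borel_measurable_times borel_measurable_const measurable_T_integrand)
    show "AE x in P. x powr (- (a - 1) / 2) * exp (- lam * t * x / (1 - t)) *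
        bessel_I (a - 1) (2 * lam * sqrt (u * x * t) / (1 - t))
        = ?K * (x ^ 0 * exp (- ?r * x) * hyp01 (a + real 0) (?c * x))"
      using pos
    proof eventually_elim
      case (elim x)
      let ?z = "2 * lam * sqrt (u * x * t) / (1 - t)"
      have z: "?z / 2 = ?b * sqrt (u * t * x)"
      proof -
        have "2 * l * s / d / 2 = l / d * s" for l s d :: real by simp
        then show ?thesis by (simp only: mult.assoc mult.commute[of t x])
      qed
      have zpos: "?z > 0" using elim t u lam by simp
      have sq: "(?z / 2)\<^sup>2 = ?c * x"
        unfolding z b power_mult_distrib using elim t u by (simp add: power2_eq_square)
      have s: "sqrt (u * t * x) = (u * t * x) powr (1 / 2)"
        using elim t u by (intro powr_half_sqrt[symmetric]) simp
      have "(?z / 2) powr (a - 1) = ?b powr (a - 1) * (u * t * x) powr ((a - 1) / 2)"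
        unfolding z powr_mult[of ?b] s powr_powr by simp
      also have "(u * t * x) powr ((a - 1) / 2) = (u * t) powr ((a - 1) / 2) * x powr ((a - 1) / 2)"
        by (rule powr_mult)
      finally have zp: "(?z / 2) powr (a - 1) = ?b powr (a - 1) * ((u * t) powr ((a - 1) / 2) * x powr ((a - 1) / 2))" .
      have "x powr (- (a - 1) / 2) * x powr ((a - 1) / 2) = 1"
        using elim unfolding powr_add[symmetric] by (simp add: add_divide_distrib[symmetric])
      then have k: "x powr (- (a - 1) / 2) * ((?z / 2) powr (a - 1) / Gamma a) = ?K"
        unfolding zp by (simp add: mult_ac)
      have e: "exp (- lam * t * x / (1 - t)) = exp (- ?r * x)" by simp
      have "x powr (- (a - 1) / 2) * q * ((?z / 2) powr (a - 1) / Gamma a * w) = ?K * (x ^ 0 * q * w)" for q w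
        unfolding k[symmetric] by simp
      then show ?case
        unfolding bessel_I_eq_hyp01[OF a zpos] sq e of_nat_0 add_0_right .
    qed
  qed
  also have "\<dots> = ?K * T 0 0 ?r ?c"
    by (simp add: T_def)
  finally have "smart_path_dens a lam P t u = ?b * (u / t) powr ((a - 1) / 2) * exp (- lam * u / (1 - t)) * (?K * T 0 0 ?r ?c)"
    unfolding smart_path_dens_def by simp
  also have "\<dots> = (?b * ?b powr (a - 1)) * ((u / t) powr ((a - 1) / 2) * (u * t) powr ((a - 1) / 2)) / Gamma a
      * exp (- lam * u / (1 - t)) * T 0 0 ?r ?c"
    by (simp add: mult_ac)
  also have "?b * ?b powr (a - 1) = ?b powr a"
    using powr_mult_base[OF less_imp_le[OF bpos], of "a - 1"] by simp
  also have "(u / t) powr ((a - 1) / 2) * (u * t) powr ((a - 1) / 2) = u powr (a - 1)"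
  proof -
    have sq: "u / t * (u * t) = u powr 2" and half: "2 * ((a - 1) / 2) = a - 1"
      using t u by (simp_all add: power2_eq_square)
    show ?thesis unfolding powr_mult[symmetric] sq powr_powr half ..
  qed
  also have "?b powr a = lam powr a * ((lam + ?r) / lam) powr a"
    unfolding b using lam t by (simp add: powr_divide)
  also have "exp (- lam * u / (1 - t)) = exp (- lam * u) * exp (- ?r * u)"
  proof -
    have "- lam * u / (1 - t) = - (lam + ?r) * u" unfolding b by simp
    then show ?thesis by (simp add: exp_add[symmetric] algebra_simps)
  qed
  finally show ?thesis
    by (simp add: gamma_dens_def h_def mult_ac)
qed

lemma smart_path_entropy_integrand_eq:
  assumes "0 < t" "t < 1" "0 < u"
  shows "smart_path_dens a lam P t u * ln (smart_path_dens a lam P t u / gamma_dens a lam u)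
    = gamma_dens a lam u * h (lam * t / (1 - t)) u * ln (h (lam * t / (1 - t)) u)"
  using gamma_dens_pos[of u] assms by (simp add: smart_path_dens_eq)

lemma has_real_derivative_smart_path_dens:
  assumes t: "0 < t" "t < 1" and u: "0 < u"
  shows "(smart_path_dens a lam P t has_real_derivative
    gamma_dens a lam u * ((a - 1) / u - lam) * h (lam * t / (1 - t)) u + h_u (lam * t / (1 - t)) u * gamma_dens a lam u) (at u)"
\<comment> \<open>The product formula holds for positive arguments, hence the transfer on the open
  half-line.\<close>
proof (rule has_field_derivative_transform_within_open[of _ _ _ "{0<..}"])
  show "((\<lambda>u. gamma_dens a lam u * h (lam * t / (1 - t)) u) has_real_derivative
    gamma_dens a lam u * ((a - 1) / u - lam) * h (lam * t / (1 - t)) u + h_u (lam * t / (1 - t)) u * gamma_dens a lam u) (at u)"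
    using assms lam by (intro DERIV_mult has_real_derivative_gamma_dens has_real_derivative_h) auto
qed (use assms smart_path_dens_eq in auto)

text \<open>The gamma density has score \<open>(a - 1) / u - lam\<close>, so the standardisation
  subtracts it and leaves the relative score \<open>h_u / h\<close>.\<close>

lemma fisher_integrand_smart_path_eq:
  assumes t: "0 < t" "t < 1" and u: "0 < u"
  shows "fisher_integrand a lam (smart_path_dens a lam P t) u
    = gamma_dens a lam u * u * (h_u (lam * t / (1 - t)) u)\<^sup>2 / h (lam * t / (1 - t)) u"
proof -
  let ?r = "lam * t / (1 - t)" and ?g = "gamma_dens a lam u"
  have p: "h ?r u > 0" "?g > 0" using assms lam by (auto intro: h_pos gamma_dens_pos)
  have "((\<lambda>v. ln (smart_path_dens a lam P t v)) has_real_derivative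
      inverse (?g * h ?r u) * (?g * ((a - 1) / u - lam) * h ?r u + h_u ?r u * ?g)) (at u)"
    unfolding smart_path_dens_eq[OF assms, symmetric]
    by (rule DERIV_chain2[OF DERIV_ln has_real_derivative_smart_path_dens[OF assms, folded smart_path_dens_eq[OF assms]]])
      (use p smart_path_dens_eq[OF assms] in simp)
  moreover have "inverse (?g * h ?r u) * (?g * ((a - 1) / u - lam) * h ?r u + h_u ?r u * ?g)
      = (a - 1) / u - lam + h_u ?r u / h ?r u"
    using p by (simp add: field_simps)
  ultimately have "deriv (\<lambda>v. ln (smart_path_dens a lam P t v)) u = (a - 1) / u - lam + h_u ?r u / h ?r u"
    using DERIV_imp_deriv by metis
  then show ?thesis
    using p unfolding fisher_integrand_def smart_path_dens_eq[OF assms]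
    by (simp add: power_divide) (simp add: power2_eq_square)
qed

lemma has_real_derivative_rel_entropy:
  assumes t: "0 < t" "t < 1"
  shows "((\<lambda>t. rel_entropy_gamma a lam (smart_path_dens a lam P t)) has_real_derivative
    1 / (lam * t) * J_st_gamma a lam (smart_path_dens a lam P t)) (at t)"
proof (rule has_field_derivative_transform_within_open[of _ _ _ "{0<..<1}"])
  let ?\<rho> = "\<lambda>t. lam * t / (1 - t)"
  let ?E = "\<lambda>r. LBINT u:{0<..}. gamma_dens a lam u * h r u * ln (h r u)"
  let ?r = "?\<rho> t"
  have r: "?r > 0" using t lam by simp
  have b: "lam + ?r = lam / (1 - t)" using t by (simp add: field_simps)
  have J: "J_st_gamma a lam (smart_path_dens a lam P t)
      = (LBINT u:{0<..}. gamma_dens a lam u * u * (h_u ?r u)\<^sup>2 / h ?r u)" (is "_ = ?J")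
    unfolding J_st_gamma_def
    by (rule set_lebesgue_integral_cong) (auto simp: fisher_integrand_smart_path_eq[OF t])
  have "(?\<rho> has_real_derivative lam / (1 - t)\<^sup>2) (at t)"
    using t by (auto intro!: derivative_eq_intros simp: power2_eq_square field_simps)
  then have "((\<lambda>t. ?E (?\<rho> t)) has_real_derivative 1 / (?r * (lam + ?r)) * ?J * (lam / (1 - t)\<^sup>2)) (at t)"
    by (rule DERIV_chain2[where f = ?E and g = ?\<rho> and x = t, OF has_real_derivative_entropy[OF r]])
  \<comment> \<open>\<open>r * (lam + r) = lam\<^sup>2 * t / (1 - t)\<^sup>2\<close> and
    \<open>dr/dt = lam / (1 - t)\<^sup>2\<close>, whose quotient leaves
    \<open>1 / (lam * t)\<close>.\<close>
  moreover have "1 / (?r * (lam + ?r)) * ?J * (lam / (1 - t)\<^sup>2) = 1 / (lam * t) * ?J"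
    unfolding b using t lam by (simp add: power2_eq_square)
  ultimately show "((\<lambda>t. ?E (?\<rho> t)) has_real_derivative 1 / (lam * t) * J_st_gamma a lam (smart_path_dens a lam P t)) (at t)"
    unfolding J by simp
  show "?E (?\<rho> s) = rel_entropy_gamma a lam (smart_path_dens a lam P s)" if "s \<in> {0<..<1}" for s
    unfolding rel_entropy_gamma_def using that
    by (intro set_lebesgue_integral_cong) (auto simp: smart_path_entropy_integrand_eq)
qed (use t in auto)

end

text \<open>Both integrability claims are part of the statement because the integral of a
  nonintegrable function is 0 by convention; positivity and differentiability make
  \<open>deriv\<close> in the Fisher information a genuine score.\<close>

theorem theorem4p1:
  fixes a lam :: real and P :: "real measure"
  assumes "a \<ge> 1/2" and "lam > 0"
    and "prob_space P" and "sets P = sets borel"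
    and "AE x in P. x > 0"
    and "integrable P (\<lambda>x. x powr (a + 4))"
  shows "\<forall>\<tau> \<in> {0<..<1}.
     set_integrable lborel {0<..}
       (\<lambda>u. smart_path_dens a lam P \<tau> u * ln (smart_path_dens a lam P \<tau> u / gamma_dens a lam u))
   \<and> (\<forall>u>0. smart_path_dens a lam P \<tau> u > 0 \<and> (smart_path_dens a lam P \<tau>) differentiable (at u))
   \<and> set_integrable lborel {0<..} (fisher_integrand a lam (smart_path_dens a lam P \<tau>))
   \<and> ((\<lambda>t. rel_entropy_gamma a lam (smart_path_dens a lam P t)) has_real_derivative
        (1 / (lam * \<tau>) * J_st_gamma a lam (smart_path_dens a lam P \<tau>))) (at \<tau>)"
proof (intro ballI conjI allI impI)
  interpret gamma_mixing P a lam
    using assms by (intro gamma_mixing.intro gamma_mixing_axioms.intro)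
  fix t :: real
  assume "t \<in> {0<..<1}"
  then have t: "0 < t" "t < 1" by auto
  define r where "r = lam * t / (1 - t)"
  have r: "r > 0" using t lam by (simp add: r_def)
  show "set_integrable lborel {0<..}
       (\<lambda>u. smart_path_dens a lam P t u * ln (smart_path_dens a lam P t u / gamma_dens a lam u))"
    by (rule set_integrable_cong[THEN iffD2, OF refl refl _ integrable_h_ln[OF r]])
      (simp add: smart_path_entropy_integrand_eq t r_def)
  show "set_integrable lborel {0<..} (fisher_integrand a lam (smart_path_dens a lam P t))"
    by (rule set_integrable_cong[THEN iffD2, OF refl refl _ integrable_fisher[OF r]])
      (simp add: fisher_integrand_smart_path_eq t r_def)
  show "((\<lambda>t. rel_entropy_gamma a lam (smart_path_dens a lam P t)) has_real_derivative
        (1 / (lam * t) * J_st_gamma a lam (smart_path_dens a lam P t))) (at t)"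
    by (rule has_real_derivative_rel_entropy[OF t])
  fix u :: real
  assume u: "0 < u"
  show "smart_path_dens a lam P t u > 0"
    using smart_path_dens_eq[OF t u] h_pos[OF r u] gamma_dens_pos[OF u] by (simp add: r_def)
  show "smart_path_dens a lam P t differentiable (at u)"
    using has_real_derivative_smart_path_dens[OF t u] by (auto simp: real_differentiable_def)
qed

end
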